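(* Let $0<p<1$. Then the set \[ \mathcal{L}(\ell_p;\ell_p)\setminus \bigcup_{1\le s\le r<\infty}\Pi_{(r,s)}(\ell_p;\ell_p) \] is $\mathfrak{c}$-lineable, i.e. there is a linear subspace of $\mathcal{L}(\ell_p;\ell_p)$ of dimension $\mathfrak{c}$ all of whose nonzero elements are bounded linear operators $\ell_p\to\ell_p$ that are not absolutely $(r,s)$-summing for any real numbers $r,s$ with $1\le s\le r<\infty$. Moreover, the analogous statement fails for every $p\ge 1$: for $p\ge1$ (with $\ell_p$ the usual Banach space) one has $\mathcal{L}(\ell_p;\ell_p)\setminus \bigcup_{1\le s\le r<\infty}\Pi_{(r,s)}(\ell_p;\ell_p)=\emptyset$.
   Context: For $0<p<1$, $\ell_p$ is the space of scalar sequences $x=(x_k)$ with $\|x\|_p=(\sum_k|x_k|^p)^{1/p}<\infty$ (a $p$-Banach, non-locally convex space); for $p\ge1$ it is the usual Banach space. $\mathcal{L}(E;F)$ denotes the space of bounded linear operators from $E$ to $F$. For $p$-normed spaces $E,F$ whose topological dual $E'$ is nontrivial (e.g. $E=\ell_p$, $0<p<1$) and $1\le s\le r<\infty$, a linear operator $T:E\to F$ is absolutely $(r,s)$-summing if $\sum_k\|T(x_k)\|^r<\infty$ whenever $(x_k)_{k=1}^\infty$ is a sequence in $E$ such that $\sum_k|f(x_k)|^s<\infty$ for every $f\in E'$; $\Pi_{(r,s)}(E;F)$ denotes the set of such operators. A subset $A$ of a vector space is $\mu$-lineable if $A\cup\{0\}$ contains a linear subspace of dimension $\mu$. $\mathfrak{c}$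 denotes the cardinality of $\mathbb{R}$. Scalars are $\mathbb{K}=\mathbb{R}$ or $\mathbb{C}$. *)

theory Defs
  imports "HOL-Analysis.Analysis" "HOL-Library.Equipollence" "HOL-Library.Function_Algebras"
begin

text \<open>Scalar sequences over a field 'a (intended: real or complex, i.e. real_normed_field).\<close>

definition lp_space :: "real \<Rightarrow> (nat \<Rightarrow> 'a::real_normed_field) set" where
  "lp_space p = {x. summable (\<lambda>k. norm (x k) powr p)}"

definition lp_norm :: "real \<Rightarrow> (nat \<Rightarrow> 'a::real_normed_field) \<Rightarrow> real" where
  "lp_norm p x = (\<Sum>k. norm (x k) powr p) powr (1 / p)"

definition lin_on_lp :: "real \<Rightarrow> ((nat \<Rightarrow> 'a::real_normed_field) \<Rightarrow> 'b) \<Rightarrow> ('b \<Rightarrow> 'b \<Rightarrow> 'b) \<Rightarrow> ('a \<Rightarrow> 'b \<Rightarrow> 'b) \<Rightarrow> bool" where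
  "lin_on_lp p T ad sc \<longleftrightarrow>
     (\<forall>x\<in>lp_space p. \<forall>y\<in>lp_space p. T (\<lambda>k. x k + y k) = ad (T x) (T y)) \<and>
     (\<forall>c. \<forall>x\<in>lp_space p. T (\<lambda>k. c * x k) = sc c (T x))"

text \<open>Bounded linear operators l_p -> l_p; to make this a genuine vector space of operators,
  they are normalised to be 0 outside l_p (so they are determined by their action on l_p).\<close>
definition bounded_ops :: "real \<Rightarrow> ((nat \<Rightarrow> 'a::real_normed_field) \<Rightarrow> (nat \<Rightarrow> 'a)) set" where
  "bounded_ops p = {T.
     lin_on_lp p T (\<lambda>y z k. y k + z k) (\<lambda>c y k. c * y k) \<and>
     (\<forall>x\<in>lp_space p. T x \<in> lp_space p) \<and>
     (\<exists>C. \<forall>x\<in>lp_space p. lp_norm p (T x) \<le> C * lp_norm p x) \<and>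
     (\<forall>x. x \<notin> lp_space p \<longrightarrow> T x = (\<lambda>k. 0))}"

definition lp_dual :: "real \<Rightarrow> ((nat \<Rightarrow> 'a::real_normed_field) \<Rightarrow> 'a) set" where
  "lp_dual p = {f.
     lin_on_lp p f (+) (\<lambda>c y. c * y) \<and>
     (\<exists>C. \<forall>x\<in>lp_space p. norm (f x) \<le> C * lp_norm p x)}"

definition abs_summing :: "real \<Rightarrow> real \<Rightarrow> real \<Rightarrow> ((nat \<Rightarrow> 'a::real_normed_field) \<Rightarrow> (nat \<Rightarrow> 'a)) \<Rightarrow> bool" where
  "abs_summing p r s T \<longleftrightarrow>
     (\<forall>x :: nat \<Rightarrow> (nat \<Rightarrow> 'a).
        (\<forall>k. x k \<in> lp_space p) \<longrightarrow>
        (\<forall>f\<in>lp_dual p. summable (\<lambda>k. norm (f (x k)) powr s)) \<longrightarrow>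
        summable (\<lambda>k. lp_norm p (T (x k)) powr r))"

definition op_scale :: "'a::real_normed_field \<Rightarrow> ((nat \<Rightarrow> 'a) \<Rightarrow> (nat \<Rightarrow> 'a)) \<Rightarrow> ((nat \<Rightarrow> 'a) \<Rightarrow> (nat \<Rightarrow> 'a))" where
  "op_scale c T = (\<lambda>x k. c * T x k)"

end

theory Submission
  imports Defs "HOL-Computational_Algebra.Fundamental_Theorem_Algebra"
begin

text \<open>
  For \<open>p < 1\<close>, the normalised indicator of a block of \<open>2 ^ k\<close> coordinates has norm \<open>1\<close>, but its
  \<open>\<ell>\<^sub>1\<close>-norm, which controls its image under every functional, decays geometrically in \<open>k\<close>. Hence
  multiplication by a sequence that is constant on blocks is not summing unless the sequence tends to
  \<open>0\<close>. Indicators of an almost disjoint family of continuum many sets of blocks span a space of such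
  sequences in which every nonzero element takes a fixed nonzero value infinitely often.

  For \<open>p \<ge> 1\<close>, the Orlicz property shows that every bounded operator is \<open>(max 2 p, 1)\<close>-summing. By
  uniform boundedness, the signed sums of a weakly \<open>1\<close>-summable sequence are bounded in \<open>\<ell>\<^sub>p\<close>, and
  averaging over the signs with Khinchine's inequality in every coordinate bounds the norms. As the
  scalars range over an arbitrary real normed field, completeness and the parallelogram law come from
  Ostrowski's theorem that such a field is isometric to the reals or the complex numbers.
\<close>

section \<open>Ostrowski's theorem\<close>

definition real_poly_eval :: "real poly \<Rightarrow> 'a::real_normed_field \<Rightarrow> 'a" where
  "real_poly_eval P x = poly (map_poly of_real P) x"

lemma real_poly_eval_0 [simp]: "real_poly_eval 0 x = 0"
  by (simp add: real_poly_eval_def)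

lemma real_poly_eval_pCons [simp]:
  "real_poly_eval (pCons a P) x = of_real a + x * real_poly_eval P x"
  by (simp add: real_poly_eval_def map_poly_pCons)

lemma real_poly_eval_add [simp]:
  "real_poly_eval (P + Q) x = real_poly_eval P x + real_poly_eval Q x"
  by (induction P Q rule: poly_induct2) (simp_all add: algebra_simps)

lemma real_poly_eval_smult [simp]:
  "real_poly_eval (smult a P) x = of_real a * real_poly_eval P x"
  by (induction P) (simp_all add: algebra_simps)

lemma real_poly_eval_mult [simp]:
  "real_poly_eval (P * Q) x = real_poly_eval P x * real_poly_eval Q x"
  by (induction P) (simp_all add: algebra_simps)

lemma real_poly_eval_1 [simp]: "real_poly_eval 1 x = 1"
  by (simp add: one_pCons)

lemma real_poly_eval_power [simp]:
  "real_poly_eval (P ^ n) x = real_poly_eval P x ^ n"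
  by (induction n) simp_all

lemma real_poly_eval_of_real: "real_poly_eval P (of_real r) = of_real (poly P r)"
  by (induction P) simp_all

text \<open>A complex root \<open>z\<close> provides the factor: linear if \<open>z\<close> is real,
  otherwise \<open>(X - a)^2 + c\<close> with \<open>a = Re z\<close> and
  \<open>c = (Im z)^2\<close>. The second shape is the one whose norm is minimised below.\<close>

lemma real_poly_monic_factor:
  fixes P :: "real poly"
  assumes "lead_coeff P = 1" "degree P > 0"
  obtains a Q where "P = [:- a, 1:] * Q"
  | a c Q where "c \<ge> 0" "P = [:a\<^sup>2 + c, - 2 * a, 1:] * Q"
proof -
  have "degree (map_poly complex_of_real P) = degree P"
    by (rule degree_map_poly) simp
  with assms have "\<not> constant (poly (map_poly complex_of_real P))"
    by (simp add: constant_degree)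
  then obtain z where "poly (map_poly complex_of_real P) z = 0"
    using fundamental_theorem_of_algebra by blast
  then have z: "real_poly_eval P z = 0"
    by (simp add: real_poly_eval_def)
  show ?thesis
  proof (cases "Im z = 0")
    case True
    then have "z = of_real (Re z)"
      by (simp add: complex_eq_iff)
    with z have "poly P (Re z) = 0"
      by (metis real_poly_eval_of_real of_real_eq_0_iff)
    then show ?thesis
      using that(1) by (auto simp: poly_eq_0_iff_dvd elim: dvdE)
  next
    case False
    define q where "q = [:(Re z)\<^sup>2 + (Im z)\<^sup>2, - 2 * Re z, 1:]"
    have qz: "real_poly_eval q z = 0"
      by (simp add: q_def complex_eq_iff power2_eq_square algebra_simps)
    have "P = q * (P div q) + P mod q"
      by simp
    then have "real_poly_eval P z = real_poly_eval q z * real_poly_eval (P div q) z + real_poly_eval (P mod q) z"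
      by (metis real_poly_eval_add real_poly_eval_mult)
    with z qz have mz: "real_poly_eval (P mod q) z = 0"
      by simp
    have "degree q = 2" "q \<noteq> 0"
      by (simp_all add: q_def)
    then have "P mod q = 0 \<or> degree (P mod q) < 2"
      by (metis degree_mod_less)
    then have "degree (P mod q) \<le> 1"
      by auto
    \<comment> \<open>A real polynomial of degree at most 1 that vanishes at a non-real point is 0,
      so \<open>q\<close> divides \<open>P\<close>.\<close>
    then have "P mod q = [:coeff (P mod q) 0, coeff (P mod q) 1:]"
      by (intro poly_eqI) (auto simp: coeff_pCons coeff_eq_0 split: nat.split)
    then obtain a b where ab: "P mod q = [:a, b:]" by blast
    with mz have "a + b * Re z = 0" "b * Im z = 0"
      by (simp_all add: complex_eq_iff mult.commute disj_commute)
    with False have "P mod q = 0"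
      by (simp add: ab)
    then have "P = q * (P div q)"
      using \<open>P = q * (P div q) + P mod q\<close> by simp
    then show ?thesis
      unfolding q_def using that(2)[of "(Im z)\<^sup>2"] by simp
  qed
qed

text \<open>The norm is multiplicative, so it suffices to bound the irreducible real factors: a
  linear one has squared norm at least \<open>m\<close> (the case \<open>c = 0\<close>), a quadratic
  one at least \<open>m ^ 2\<close>. Each degree thus contributes one factor
  \<open>m\<close>.\<close>

lemma norm_real_poly_eval_ge:
  fixes x :: "'a::real_normed_field"
  assumes m: "\<And>a c. c \<ge> 0 \<Longrightarrow> m \<le> norm ((x - of_real a)\<^sup>2 + of_real c)" and "m \<ge> 0"
    and "lead_coeff P = 1"
  shows "m ^ degree P \<le> (norm (real_poly_eval P x))\<^sup>2"
  using \<open>lead_coeff P = 1\<close>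
proof (induction "degree P" arbitrary: P rule: less_induct)
  case less
  show ?case
  proof (cases "degree P = 0")
    case True
    with less have "P = 1"
      by (metis lead_coeff_pCons(2) degree_eq_zeroE one_pCons)
    then show ?thesis by simp
  next
    case False
    have *: "m ^ degree P \<le> (norm (real_poly_eval P x))\<^sup>2"
      if P: "P = q * Q" and q: "lead_coeff q = 1" "degree q > 0"
        "m ^ degree q \<le> (norm (real_poly_eval q x))\<^sup>2" for q Q
    proof -
      have Q: "lead_coeff Q = 1"
        using less.prems q unfolding P lead_coeff_mult by simp
      then have "Q \<noteq> 0" "q \<noteq> 0" using q by auto
      then have d: "degree P = degree q + degree Q"
        unfolding P by (rule degree_mult_eq[rotated])
      have "m ^ degree Q \<le> (norm (real_poly_eval Q x))\<^sup>2"
        using less.hyps[of Q] d q Q by simp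
      with q(3) show ?thesis
        unfolding d power_add unfolding P
        by (simp add: norm_mult power_mult_distrib mult_mono \<open>m \<ge> 0\<close>)
    qed
    from less.prems False have "degree P > 0" by simp
    from less.prems this show ?thesis
    proof (cases rule: real_poly_monic_factor)
      case (1 a Q)
      then show ?thesis
        by (rule *) (use m[of 0 a] in \<open>simp_all add: norm_power\<close>)
    next
      case (2 a c Q)
      have eq: "of_real (a\<^sup>2 + c) + x * (of_real (- 2 * a) + x) = (x - of_real a)\<^sup>2 + of_real c"
        by (simp add: power2_eq_square algebra_simps)
      have "m ^ 2 \<le> (norm ((x - of_real a)\<^sup>2 + of_real c))\<^sup>2"
        using m[OF 2(1), of a] \<open>m \<ge> 0\<close> by (intro power_mono) 
      then have "m ^ 2 \<le> (norm (real_poly_eval [:a\<^sup>2 + c, - 2 * a, 1:] x))\<^sup>2"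
        by (simp add: eq[symmetric])
      then show ?thesis
        by (intro *[OF 2(2)]) (simp_all add: numeral_2_eq_2)
    qed
  qed
qed

section \<open>Every element is a root of a real quadratic\<close>

text \<open>Let \<open>h\<close> be the quadratic attaining the minimum \<open>m\<close> at
  \<open>x\<close>. Then \<open>h + e\<close> divides \<open>h ^ (n + 1) - (- e) ^ (n + 1)\<close>,
  and the cofactor \<open>Q\<close> is monic of degree \<open>2 * n\<close>, hence at least
  \<open>m ^ n\<close> in norm at \<open>x\<close>. So the value of \<open>h + e\<close> has norm at
  most \<open>m * (1 + (e / m) ^ (n + 1))\<close>, which tends to \<open>m\<close>.\<close>

lemma norm_quadratic_minimum_propagates:
  fixes x :: "'a::real_normed_field"
  assumes m: "\<And>a c. c \<ge> 0 \<Longrightarrow> m \<le> norm ((x - of_real a)\<^sup>2 + of_real c)"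
    and eq: "norm ((x - of_real a)\<^sup>2 + of_real c) = m" and "c \<ge> 0" "0 < e" "e < m"
  shows "norm ((x - of_real a)\<^sup>2 + of_real (c + e)) = m"
proof (rule antisym)
  define h where "h = [:a\<^sup>2 + c, - 2 * a, 1:]"
  have hx: "real_poly_eval h x = (x - of_real a)\<^sup>2 + of_real c"
    by (simp add: h_def power2_eq_square algebra_simps)
  define y where "y = real_poly_eval (h - [:-e:]) x"
  have y: "y = (x - of_real a)\<^sup>2 + of_real (c + e)"
  proof -
    have "h - [:-e:] = h + [:e:]" by simp
    then show ?thesis unfolding y_def by (simp only: real_poly_eval_add hx) simp
  qed
  have h: "degree h = 2" "lead_coeff h = 1"
    by (simp_all add: h_def)
  have "norm y \<le> m * (1 + (e / m) ^ Suc n)" for n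
  proof -
    define Q where "Q = (\<Sum>i<Suc n. [:-e:] ^ (Suc n - Suc i) * h ^ i)"
    define R where "R = h ^ Suc n - [:-e:] ^ Suc n"
    have R: "R = (h - [:-e:]) * Q"
      unfolding Q_def R_def by (rule power_diff_sumr2)
    have "[:-e:] ^ Suc n = [:(-e) ^ Suc n:]"
      by (simp add: poly_const_pow)
    then have R': "R = h ^ Suc n + [:- ((-e) ^ Suc n):]"
      by (simp add: R_def)
    have "h \<noteq> 0" using h by auto
    then have dh: "degree (h ^ Suc n) = 2 * Suc n"
      using h by (subst degree_power_eq) (simp_all del: power_Suc)
    then have "degree R = 2 * Suc n"
      unfolding R' by (subst degree_add_eq_left) auto
    moreover have "coeff R (2 * Suc n) = coeff (h ^ Suc n) (2 * Suc n)"
      unfolding R' by (simp add: coeff_pCons)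
    moreover have "coeff (h ^ Suc n) (2 * Suc n) = 1"
      using h dh lead_coeff_power[of h "Suc n"] by simp
    ultimately have lR: "degree R = 2 * Suc n" "lead_coeff R = 1" by auto
    have g: "degree (h - [:-e:]) = 2" "lead_coeff (h - [:-e:]) = 1"
      by (simp_all add: h_def)
    have lQ: "lead_coeff Q = 1"
      using lR(2) g(2) unfolding R lead_coeff_mult by simp
    have "degree R = 2 + degree Q"
      unfolding R using g lQ by (subst degree_mult_eq) auto
    then have dQ: "degree Q = 2 * n" using lR by simp
    have "m \<ge> 0" using assms by simp
    from norm_real_poly_eval_ge[OF m this lQ]
    have "(m ^ n)\<^sup>2 \<le> (norm (real_poly_eval Q x))\<^sup>2"
      by (simp add: dQ power_mult mult.commute flip: power_mult)
    then have Qx: "m ^ n \<le> norm (real_poly_eval Q x)"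
      by (rule power2_le_imp_le) simp
    have "norm y * m ^ n \<le> norm y * norm (real_poly_eval Q x)"
      using Qx by (rule mult_left_mono) simp
    also have "\<dots> = norm (real_poly_eval R x)"
      unfolding R y_def by (simp add: norm_mult)
    also have "\<dots> = norm ((real_poly_eval h x) ^ Suc n + of_real (- ((-e) ^ Suc n)))"
      unfolding R' real_poly_eval_add real_poly_eval_power by simp
    also have "\<dots> \<le> norm ((real_poly_eval h x) ^ Suc n) + norm (of_real (- ((-e) ^ Suc n)) :: 'a)"
      by (rule norm_triangle_ineq)
    also have "\<dots> = m ^ Suc n + e ^ Suc n"
      unfolding hx norm_power eq norm_of_real using \<open>0 < e\<close>
      by (simp add: abs_mult power_abs)
    finally have "norm y * m ^ n \<le> m ^ Suc n + e ^ Suc n" .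
    moreover have "m ^ Suc n + e ^ Suc n = m * (1 + (e / m) ^ Suc n) * m ^ n"
      using \<open>0 < e\<close> \<open>e < m\<close> by (simp add: distrib_left distrib_right power_divide)
    ultimately have "norm y * m ^ n \<le> m * (1 + (e / m) ^ Suc n) * m ^ n" by simp
    moreover have "m ^ n > 0" using \<open>0 < e\<close> \<open>e < m\<close> by simp
    ultimately show ?thesis by (rule mult_right_le_imp_le)
  qed
  moreover have "(\<lambda>n. m * (1 + (e / m) ^ Suc n)) \<longlonglongrightarrow> m * (1 + 0)"
    using assms by (intro tendsto_intros LIMSEQ_Suc[OF LIMSEQ_realpow_zero]) auto
  ultimately show "norm ((x - of_real a)\<^sup>2 + of_real (c + e)) \<le> m"
    unfolding y[symmetric] using LIMSEQ_le_const[of _ "m * (1 + 0)" "norm y"] by auto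
  show "m \<le> norm ((x - of_real a)\<^sup>2 + of_real (c + e))"
    using m[of "c + e" a] \<open>c \<ge> 0\<close> \<open>0 < e\<close> by (simp del: of_real_add)
qed

text \<open>The norm of \<open>(x - a)^2 + c\<close> is coercive in \<open>(a, c)\<close> for
  \<open>c \<ge> 0\<close>, so it attains a minimum \<open>m\<close>. If \<open>m > 0\<close>,
  propagation would keep the value \<open>m\<close> along an unbounded sequence of \<open>c\<close>,
  against coercivity.\<close>

lemma real_normed_field_quadratic:
  fixes x :: "'a::real_normed_field"
  obtains a c where "c \<ge> 0" "(x - of_real a)\<^sup>2 + of_real c = 0"
proof -
  define F where "F = (\<lambda>u::real \<times> real. norm ((x - of_real (fst u))\<^sup>2 + of_real (snd u)))"
  define M where "M = norm x"
  \<comment> \<open>Large enough that outside the box \<open>K\<close> the coercive lower bound is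
    at least \<open>M^2\<close>, the value at \<open>(0, 0)\<close>.\<close>
  define R where "R = 3 * M + 3"
  have "M \<ge> 0" by (simp add: M_def)
  have coer: "a\<^sup>2 + c - 2 * \<bar>a\<bar> * M - M\<^sup>2 \<le> F (a, c)" if "c \<ge> 0" for a c
  proof -
    have "of_real (a\<^sup>2 + c) = ((x - of_real a)\<^sup>2 + of_real c) + (2 * of_real a * x - x\<^sup>2)"
      by (simp add: power2_eq_square algebra_simps)
    then have "norm (of_real (a\<^sup>2 + c) :: 'a) \<le> F (a, c) + norm (2 * of_real a * x - x\<^sup>2)"
      unfolding F_def by (simp only: fst_conv snd_conv norm_triangle_ineq)
    also have "norm (2 * of_real a * x - x\<^sup>2) \<le> norm (2 * of_real a * x) + norm (x\<^sup>2)"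
      by (rule norm_triangle_ineq4)
    also have "\<dots> = 2 * \<bar>a\<bar> * M + M\<^sup>2"
      by (simp add: norm_mult norm_power M_def)
    finally show ?thesis using that unfolding norm_of_real by simp
  qed
  define K where "K = {- R .. R} \<times> {0 .. R\<^sup>2}"
  have "compact K" unfolding K_def by (intro compact_Times compact_Icc)
  moreover have "(0, 0) \<in> K" using \<open>M \<ge> 0\<close> by (simp add: K_def R_def)
  moreover have "continuous_on K F" unfolding F_def by (intro continuous_intros)
  ultimately obtain u where u: "u \<in> K" "\<And>v. v \<in> K \<Longrightarrow> F u \<le> F v"
    using continuous_attains_inf[of K F] by blast
  have min: "F u \<le> F (a, c)" if "c \<ge> 0" for a c
  proof (cases "(a, c) \<in> K")
    case False
    have "F u \<le> F (0, 0)" using u \<open>(0, 0) \<in> K\<close> by blast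
    also have "\<dots> = M\<^sup>2" by (simp add: F_def M_def norm_power)
    also have "\<dots> \<le> a\<^sup>2 + c - 2 * \<bar>a\<bar> * M - M\<^sup>2"
    proof (cases "\<bar>a\<bar> > R")
      case True
      have "3 * (\<bar>a\<bar> * M) \<le> \<bar>a\<bar> * \<bar>a\<bar>"
        using True mult_left_mono[of "3 * M" "\<bar>a\<bar>" "\<bar>a\<bar>"] by (simp add: R_def)
      moreover have "3 * (M * M) \<le> \<bar>a\<bar> * M"
        using True \<open>M \<ge> 0\<close> mult_right_mono[of "3 * M" "\<bar>a\<bar>" M] by (simp add: R_def)
      moreover have "0 \<le> M * M" by simp
      ultimately have "M * M + 2 * (\<bar>a\<bar> * M) \<le> \<bar>a\<bar> * \<bar>a\<bar> - M * M"
        by linarith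
      then show ?thesis using that by (simp add: power2_eq_square)
    next
      case False
      with \<open>(a, c) \<notin> K\<close> that have "c > R\<^sup>2" by (auto simp: K_def)
      moreover have "(\<bar>a\<bar> - M)\<^sup>2 \<ge> 0" by simp
      moreover have "3 * M\<^sup>2 \<le> R\<^sup>2"
        using \<open>M \<ge> 0\<close> unfolding R_def by (simp add: power2_eq_square algebra_simps)
      ultimately show ?thesis by (simp add: power2_eq_square algebra_simps)
    qed
    also have "\<dots> \<le> F (a, c)" by (rule coer[OF that])
    finally show ?thesis .
  qed (use u in blast)
  define m where "m = F u"
  obtain a c where ac: "u = (a, c)" by (cases u)
  have "c \<ge> 0" using u ac by (auto simp: K_def)
  have "m = 0"
  proof (rule ccontr)
    assume "m \<noteq> 0"
    then have "m > 0" by (simp add: m_def F_def)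
    \<comment> \<open>The increment \<open>m / 2\<close> lies strictly between 0 and
      \<open>m\<close>, as propagation requires, and can be repeated indefinitely.\<close>
    have step: "F (a, c + real k * (m / 2)) = m" for k
    proof (induction k)
      case 0
      show ?case by (simp add: m_def ac)
    next
      case (Suc k)
      have "norm ((x - of_real a)\<^sup>2 + of_real (c + real k * (m / 2) + m / 2)) = m"
        by (rule norm_quadratic_minimum_propagates)
          (use Suc min \<open>m > 0\<close> \<open>c \<ge> 0\<close> in \<open>auto simp: F_def m_def\<close>)
      then show ?case by (simp add: F_def algebra_simps add_divide_distrib)
    qed
    obtain k where k: "real k * (m / 2) > m + 2 * \<bar>a\<bar> * M + M\<^sup>2"
      using reals_Archimedean3[of "m / 2"] \<open>m > 0\<close> by (meson half_gt_zero)
    have "a\<^sup>2 + (c + real k * (m / 2)) - 2 * \<bar>a\<bar> * M - M\<^sup>2 \<le> m"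
      using coer[of "c + real k * (m / 2)" a] step[of k] \<open>m > 0\<close> \<open>c \<ge> 0\<close> by simp
    with k \<open>c \<ge> 0\<close> zero_le_power2[of a] show False by linarith
  qed
  then have "(x - of_real a)\<^sup>2 + of_real c = 0" by (simp add: m_def F_def ac)
  with \<open>c \<ge> 0\<close> show thesis by (rule that)
qed

section \<open>Classification of real normed fields and its consequences\<close>

text \<open>A non-real element satisfies a real quadratic without real roots, which yields a square
  root \<open>j\<close> of -1. The map sending \<open>i\<close> to \<open>j\<close> is then a
  surjective field homomorphism, and multiplicativity of both norms forces it to be
  isometric.\<close>

theorem real_normed_field_cases:
  obtains "surj (of_real :: real \<Rightarrow> 'a::real_normed_field)"
  | \<phi> :: "complex \<Rightarrow> 'a::real_normed_field" where
    "surj \<phi>" "\<And>z w. \<phi> (z + w) = \<phi> z + \<phi> w" "\<And>z. norm (\<phi> z) = norm z"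
proof (cases "surj (of_real :: real \<Rightarrow> 'a)")
  case False
  then obtain x :: 'a where x: "\<And>r. x \<noteq> of_real r" by auto
  obtain a c where c: "c \<ge> 0" and ac: "(x - of_real a)\<^sup>2 + of_real c = 0"
    by (rule real_normed_field_quadratic)
  have "c \<noteq> 0" using ac x[of a] by auto
  define j where "j = (x - of_real a) / of_real (sqrt c)"
  have "(x - of_real a)\<^sup>2 = - of_real c" using ac by (simp add: eq_neg_iff_add_eq_0)
  moreover have "(of_real (sqrt c) :: 'a)\<^sup>2 = of_real c"
    using c by (metis of_real_power real_sqrt_pow2)
  ultimately have j: "j\<^sup>2 = -1"
    using \<open>c \<noteq> 0\<close> by (simp add: j_def power_divide)
  define \<phi> where "\<phi> z = of_real (Re z) + of_real (Im z) * j" for z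
  have "surj \<phi>"
  proof (rule surjI)
    fix y :: 'a
    show "\<phi> (SOME z. \<phi> z = y) = y"
    proof (rule someI_ex)
      \<comment> \<open>The quadratic satisfied by \<open>y\<close> reads
        \<open>(y - b)^2 = (sqrt d * j)^2\<close>, so \<open>y\<close> equals \<open>b\<close> plus
        or minus \<open>sqrt d * j\<close>.\<close>
      obtain b d where d: "d \<ge> 0" and bd: "(y - of_real b)\<^sup>2 + of_real d = 0"
        by (rule real_normed_field_quadratic)
      have "(of_real (sqrt d) :: 'a)\<^sup>2 = of_real d"
        using d by (metis of_real_power real_sqrt_pow2)
      with bd have "(y - of_real b)\<^sup>2 = (of_real (sqrt d) * j)\<^sup>2"
        unfolding power_mult_distrib j by (simp add: eq_neg_iff_add_eq_0)
      then have "y - of_real b = of_real (sqrt d) * j \<or> y - of_real b = - (of_real (sqrt d) * j)"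
        by (simp add: power2_eq_iff)
      then have "y = \<phi> (Complex b (sqrt d)) \<or> y = \<phi> (Complex b (- sqrt d))"
        by (auto simp: \<phi>_def algebra_simps)
      then show "\<exists>z. \<phi> z = y" by blast
    qed
  qed
  moreover have add: "\<phi> (z + w) = \<phi> z + \<phi> w" for z w
    by (simp add: \<phi>_def algebra_simps)
  moreover have "norm (\<phi> z) = norm z" for z
  proof -
    have mult: "\<phi> (z * w) = \<phi> z * \<phi> w" for z w
    proof -
      have "\<phi> z * \<phi> w = of_real (Re z * Re w) + of_real (Im z * Im w) * j\<^sup>2
          + of_real (Re z * Im w + Im z * Re w) * j"
        by (simp add: \<phi>_def power2_eq_square algebra_simps)
      then show ?thesis by (simp add: \<phi>_def j algebra_simps)
    qed
    have one: "\<phi> 1 = 1" by (simp add: \<phi>_def)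
    have pow: "\<phi> (z ^ n) = \<phi> z ^ n" for z n
      by (induction n) (simp_all add: mult one)
    have "(norm j)\<^sup>2 = 1" using arg_cong[OF j, of norm] by (simp add: norm_power)
    then have nj: "norm j = 1" using power2_eq_imp_eq[of "norm j" 1] by simp

    \<comment> \<open>Any constant would do: applying the bound to \<open>z ^ n\<close> for all
      \<open>n\<close> improves the constant to 1, and applying the improved bound to
      \<open>inverse z\<close> gives the reverse inequality.\<close>
    have rough: "norm (\<phi> z) \<le> 2 * norm z" for z
    proof -
      have "norm (\<phi> z) \<le> \<bar>Re z\<bar> + \<bar>Im z\<bar>"
        unfolding \<phi>_def by (rule order.trans[OF norm_triangle_ineq]) (simp add: norm_mult nj)
      then show ?thesis using abs_Re_le_cmod[of z] abs_Im_le_cmod[of z] by linarith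
    qed
    have le: "norm (\<phi> z) \<le> norm z" for z
    proof (rule ccontr)
      assume "\<not> norm (\<phi> z) \<le> norm z"
      then have less: "norm z < norm (\<phi> z)" by simp
      then have "z \<noteq> 0" by (auto simp: \<phi>_def)
      with less have "norm (\<phi> z) / norm z > 1" by simp
      then obtain n where n: "2 < (norm (\<phi> z) / norm z) ^ n"
        using real_arch_pow by blast
      have "norm (\<phi> z) ^ n \<le> 2 * norm z ^ n"
        using rough[of "z ^ n"] by (simp add: pow norm_power)
      then have "(norm (\<phi> z) / norm z) ^ n \<le> 2"
        using \<open>z \<noteq> 0\<close> by (simp add: power_divide pos_divide_le_eq)
      with n show False by simp
    qed
    show "norm (\<phi> z) = norm z"
    proof (cases "z = 0")
      case False
      have "norm (\<phi> z) * norm (\<phi> (inverse z)) = 1"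
        using arg_cong[OF mult[of z "inverse z"], of norm] False by (simp add: one norm_mult)
      moreover have "norm (\<phi> z) * norm (\<phi> (inverse z)) \<le> norm (\<phi> z) * inverse (norm z)"
        using le[of "inverse z"] by (intro mult_left_mono) (auto simp: norm_inverse)
      ultimately have "1 \<le> norm (\<phi> z) * inverse (norm z)" by simp
      then have "norm z \<le> norm (\<phi> z)" using False by (simp add: pos_le_divide_eq flip: divide_inverse)
      with le show ?thesis by (simp add: antisym)
    qed (simp add: \<phi>_def)
  qed
  ultimately show thesis using that(2) by blast
qed (use that(1) in blast)

lemma real_normed_field_complete:
  fixes X :: "nat \<Rightarrow> 'a::real_normed_field"
  assumes "Cauchy X"
  shows "convergent X"
proof (cases rule: real_normed_field_cases[where 'a='a])
  case 1
  define r where "r n = inv of_real (X n)" for n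
  have r: "X n = of_real (r n)" for n
    unfolding r_def using 1 by (simp add: surj_f_inv_f)
  have "Cauchy r"
    using assms unfolding Cauchy_def r dist_norm by (simp flip: of_real_diff)
  then obtain l where "r \<longlonglongrightarrow> l" using Cauchy_convergent convergent_def by blast
  then have "(\<lambda>n. of_real (r n)) \<longlonglongrightarrow> (of_real l :: 'a)" by (rule tendsto_of_real)
  then show ?thesis unfolding r[symmetric] by (auto simp: convergent_def)
next
  case (2 \<phi>)
  define r where "r n = inv \<phi> (X n)" for n
  have r: "X n = \<phi> (r n)" for n
    unfolding r_def using 2 by (simp add: surj_f_inv_f)
  have "\<phi> z - \<phi> w = \<phi> (z - w)" for z w
    using 2(2)[of "z - w" w] by simp
  then have d: "dist (\<phi> z) (\<phi> w) = dist z w" for z w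
    by (simp add: dist_norm 2(3))
  have "Cauchy r" using assms unfolding Cauchy_def r d .
  then obtain l where "r \<longlonglongrightarrow> l" using Cauchy_convergent convergent_def by blast
  then have "X \<longlonglongrightarrow> \<phi> l" unfolding lim_sequentially r d .
  then show ?thesis by (auto simp: convergent_def)
qed

lemma real_normed_field_parallelogram:
  fixes x y :: "'a::real_normed_field"
  shows "(norm (x + y))\<^sup>2 + (norm (x - y))\<^sup>2 = 2 * (norm x)\<^sup>2 + 2 * (norm y)\<^sup>2"
proof (cases rule: real_normed_field_cases[where 'a='a])
  case 1
  then obtain r s where "x = of_real r" "y = of_real s" by (metis surjD)
  then show ?thesis by (simp flip: of_real_add of_real_diff add: power2_eq_square algebra_simps)
next
  case (2 \<phi>)
  then obtain r s where rs: "x = \<phi> r" "y = \<phi> s" by (metis surjD)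
  have "\<phi> r - \<phi> s = \<phi> (r - s)"
    using 2(2)[of "r - s" s] by simp
  then show ?thesis
    unfolding rs \<open>\<phi> r - \<phi> s = \<phi> (r - s)\<close> by (simp flip: 2(2) add: 2(3) cmod_power2 power2_sum power2_diff algebra_simps)
qed

section \<open>Khinchine's inequality\<close>

text \<open>The expectation of \<open>g (s + \<Sum>k<n. \<plusminus> a k)\<close> over independent
  uniform signs, computed by conditioning on the last sign. The free starting point \<open>s\<close>
  makes statements about it amenable to induction on \<open>n\<close>.\<close>

fun sign_mean :: "('b::ab_group_add \<Rightarrow> real) \<Rightarrow> (nat \<Rightarrow> 'b) \<Rightarrow> nat \<Rightarrow> 'b \<Rightarrow> real" where
  "sign_mean g a 0 s = g s"
| "sign_mean g a (Suc n) s = (sign_mean g a n (s + a n) + sign_mean g a n (s - a n)) / 2"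

lemma sign_mean_mono:
  assumes "\<And>s. g s \<le> h s"
  shows "sign_mean g a n s \<le> sign_mean h a n s"
proof (induction n arbitrary: s)
  case (Suc n)
  show ?case using add_mono[OF Suc[of "s + a n"] Suc[of "s - a n"]] by simp
qed (simp add: assms)

lemma sign_mean_diff:
  "sign_mean (\<lambda>s. c * g s - d * h s) a n s = c * sign_mean g a n s - d * sign_mean h a n s"
proof (induction n arbitrary: s)
  case (Suc n)
  show ?case
    unfolding sign_mean.simps Suc by (simp add: field_simps)
qed simp

lemma sign_mean_nonneg: "(\<And>s. 0 \<le> g s) \<Longrightarrow> 0 \<le> sign_mean g a n s"
  by (induction n arbitrary: s) simp_all

text \<open>Reduces the average of a sum over coordinates of a random vector to scalar averages, one
  for each coordinate.\<close>

lemma sign_mean_sum_coords: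
  fixes a :: "nat \<Rightarrow> 'i \<Rightarrow> 'b::ab_group_add"
  shows "sign_mean (\<lambda>s. \<Sum>j\<in>J. g (s j)) a n s = (\<Sum>j\<in>J. sign_mean g (\<lambda>k. a k j) n (s j))"
  by (induction n arbitrary: s) (simp_all add: sum.distrib sum_divide_distrib add_divide_distrib)

lemma sign_mean_le:
  assumes "\<And>\<epsilon> :: nat \<Rightarrow> bool. g (s + (\<Sum>k<n. if \<epsilon> k then a k else - a k)) \<le> M"
  shows "sign_mean g a n s \<le> M"
  using assms
proof (induction n arbitrary: s)
  case (Suc n)
  have "sign_mean g a n (s + (if b then a n else - a n)) \<le> M" for b
  proof (rule Suc.IH)
    fix \<epsilon> :: "nat \<Rightarrow> bool"
    have "(\<Sum>k<n. if (\<epsilon>(n := b)) k then a k else - a k) = (\<Sum>k<n. if \<epsilon> k then a k else - a k)"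
      by (intro sum.cong) auto
    with Suc.prems[of "\<epsilon>(n := b)"]
    show "g (s + (if b then a n else - a n) + (\<Sum>k<n. if \<epsilon> k then a k else - a k)) \<le> M"
      by (simp add: algebra_simps)
  qed
  from this[of True] this[of False] show ?case by simp
qed simp

lemma powr_midpoint_convex:
  assumes "p \<ge> 1" "x \<ge> 0" "y \<ge> (0::real)"
  shows "((x + y) / 2) powr p \<le> (x powr p + y powr p) / 2"
proof -
  have half: "(z / 2) powr p \<le> z powr p / 2" if "z \<ge> 0" for z :: real
  proof -
    have "(2::real) powr 1 \<le> 2 powr p" using assms by (intro powr_mono) auto
    then show ?thesis
      using that mult_left_mono[of 2 "2 powr p" "z powr p"] by (simp add: powr_divide field_simps)
  qed
  show ?thesis
  proof (cases "x = 0 \<or> y = 0")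
    case True
    then show ?thesis using half[of x] half[of y] assms by auto
  next
    case False
    have "((1 - 1/2) *\<^sub>R x + (1/2) *\<^sub>R y) powr p \<le> (1 - 1/2) * x powr p + (1/2) * y powr p"
      by (rule convex_onD[OF powr_convex]) (use assms False in auto)
    then show ?thesis by (simp add: field_simps)
  qed
qed

text \<open>Jensen's inequality, obtained by using midpoint convexity at every level of the
  recursion.\<close>

lemma sign_mean_powr:
  assumes "p \<ge> 1" "\<And>s. 0 \<le> g s"
  shows "sign_mean g a n s powr p \<le> sign_mean (\<lambda>s. g s powr p) a n s"
proof (induction n arbitrary: s)
  case (Suc n)
  have "sign_mean g a (Suc n) s powr p
      \<le> (sign_mean g a n (s + a n) powr p + sign_mean g a n (s - a n) powr p) / 2"
    unfolding sign_mean.simps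
    by (rule powr_midpoint_convex) (use assms in \<open>auto intro: sign_mean_nonneg\<close>)
  also have "\<dots> \<le> sign_mean (\<lambda>s. g s powr p) a (Suc n) s"
    using add_mono[OF Suc[of "s + a n"] Suc[of "s - a n"]] by simp
  finally show ?case .
qed simp

text \<open>By the parallelogram law the cross terms of the two signs cancel.\<close>

lemma sign_mean_norm_power2:
  fixes a :: "nat \<Rightarrow> 'a::real_normed_field"
  shows "sign_mean (\<lambda>s. (norm s)\<^sup>2) a n s = (norm s)\<^sup>2 + (\<Sum>k<n. (norm (a k))\<^sup>2)"
proof (induction n arbitrary: s)
  case (Suc n)
  then show ?case using real_normed_field_parallelogram[of s "a n"] by simp
qed simp

text \<open>The coefficients 1, 6, 3 are those of the fourth moment of a real Gaussian with mean
  \<open>norm s\<close> and variance \<open>S n\<close>; this form is stable under adding one more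
  sign.\<close>

lemma sign_mean_norm_power4:
  fixes a :: "nat \<Rightarrow> 'a::real_normed_field"
  defines "S \<equiv> \<lambda>n. \<Sum>k<n. (norm (a k))\<^sup>2"
  shows "sign_mean (\<lambda>s. (norm s) ^ 4) a n s \<le> (norm s) ^ 4 + 6 * (norm s)\<^sup>2 * S n + 3 * (S n)\<^sup>2"
proof (induction n arbitrary: s)
  case (Suc n)
  define u v P Q where "u = (norm (s + a n))\<^sup>2" and "v = (norm (s - a n))\<^sup>2"
    and "P = (norm s)\<^sup>2" and "Q = (norm (a n))\<^sup>2"
  have uv: "u + v = 2 * P + 2 * Q"
    unfolding u_def v_def P_def Q_def by (rule real_normed_field_parallelogram)
  \<comment> \<open>The upper bound on \<open>u\<close> and, through the fixed sum
    \<open>u + v\<close>, the upper bound on \<open>v\<close> confine \<open>u\<close> to distance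
    \<open>2 * norm s * norm (a n)\<close> from the midpoint \<open>P + Q\<close>. This controls
    \<open>u^2 + v^2\<close>.\<close>
  have "u \<le> (norm s + norm (a n))\<^sup>2" "v \<le> (norm s + norm (a n))\<^sup>2"
    unfolding u_def v_def by (intro power_mono norm_triangle_ineq norm_triangle_ineq4 norm_ge_zero)+
  then have "\<bar>u - (P + Q)\<bar> \<le> 2 * norm s * norm (a n)"
    using uv by (simp add: P_def Q_def power2_sum abs_le_iff)
  then have "\<bar>u - (P + Q)\<bar>\<^sup>2 \<le> (2 * norm s * norm (a n))\<^sup>2"
    by (rule power_mono) simp
  then have "(u - (P + Q))\<^sup>2 \<le> 4 * P * Q"
    by (simp add: P_def Q_def power_mult_distrib)
  moreover have v: "v = 2 * P + 2 * Q - u" using uv by simp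
  have "u\<^sup>2 + v\<^sup>2 = 2 * (P + Q)\<^sup>2 + 2 * (u - (P + Q))\<^sup>2"
    unfolding v by (simp add: power2_eq_square algebra_simps)
  ultimately have uv2: "u\<^sup>2 + v\<^sup>2 \<le> 2 * (P + Q)\<^sup>2 + 8 * P * Q" by simp
  have p4: "x ^ 4 = (x\<^sup>2)\<^sup>2" for x :: real by simp
  have "sign_mean (\<lambda>s. (norm s) ^ 4) a (Suc n) s
      \<le> ((u\<^sup>2 + 6 * u * S n + 3 * (S n)\<^sup>2) + (v\<^sup>2 + 6 * v * S n + 3 * (S n)\<^sup>2)) / 2"
    using add_mono[OF Suc[of "s + a n"] Suc[of "s - a n"]] by (simp add: u_def v_def)
  also have "\<dots> = (u\<^sup>2 + v\<^sup>2) / 2 + 3 * (u + v) * S n + 3 * (S n)\<^sup>2"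
    by (simp add: field_simps)
  also have "\<dots> \<le> (P + Q)\<^sup>2 + 4 * P * Q + 6 * (P + Q) * S n + 3 * (S n)\<^sup>2"
    using uv2 unfolding uv by simp
  \<comment> \<open>The two sides differ by \<open>2 * Q^2\<close>.\<close>
  also have "\<dots> \<le> P\<^sup>2 + 6 * P * (S n + Q) + 3 * (S n + Q)\<^sup>2"
    by (simp add: power2_eq_square algebra_simps)
  also have "\<dots> = (norm s) ^ 4 + 6 * (norm s)\<^sup>2 * S (Suc n) + 3 * (S (Suc n))\<^sup>2"
    by (simp add: S_def P_def Q_def)
  finally show ?case .
qed (simp add: S_def)

text \<open>Fourth moment method: the pointwise bound \<open>v^2 - 4/27 * v^4 \<le> v\<close> is
  applied to \<open>norm s / \<sigma>\<close> and averaged. The second moment of this quotient is 1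
  and its fourth moment at most 3, which leaves \<open>1 - 3 * 4/27 = 5/9\<close>.\<close>

lemma khinchine_L1:
  fixes a :: "nat \<Rightarrow> 'a::real_normed_field"
  shows "5 / 9 * sqrt (\<Sum>k<n. (norm (a k))\<^sup>2) \<le> sign_mean norm a n 0"
proof -
  define S where "S = (\<Sum>k<n. (norm (a k))\<^sup>2)"
  have "S \<ge> 0" by (simp add: S_def sum_nonneg)
  show ?thesis
  proof (cases "S = 0")
    case False
    define \<sigma> where "\<sigma> = sqrt S"
    have \<sigma>: "\<sigma> > 0" "\<sigma>\<^sup>2 = S" using \<open>S \<ge> 0\<close> False by (simp_all add: \<sigma>_def)
    \<comment> \<open>the quartic touches the identity at \<open>3 / 2\<close>\<close>
    have pw: "v\<^sup>2 - 4 / 27 * v ^ 4 \<le> v" if "v \<ge> 0" for v :: real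
    proof -
      have "0 \<le> 4 / 27 * v * ((v - 3 / 2)\<^sup>2 * (v + 3))" using that by simp
      also have "\<dots> = v - (v\<^sup>2 - 4 / 27 * v ^ 4)"
        by (simp add: field_simps power2_eq_square power4_eq_xxxx)
      finally show ?thesis by simp
    qed
    have pw': "1 / \<sigma> * (norm s)\<^sup>2 - 4 / (27 * \<sigma> ^ 3) * (norm s) ^ 4 \<le> norm s" for s :: 'a
    proof -
      have "\<sigma> * ((norm s / \<sigma>)\<^sup>2 - 4 / 27 * (norm s / \<sigma>) ^ 4) \<le> \<sigma> * (norm s / \<sigma>)"
        using \<sigma>(1) by (intro mult_left_mono pw) auto
      moreover have "\<sigma> * ((norm s / \<sigma>)\<^sup>2 - 4 / 27 * (norm s / \<sigma>) ^ 4)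
          = 1 / \<sigma> * (norm s)\<^sup>2 - 4 / (27 * \<sigma> ^ 3) * (norm s) ^ 4"
        using \<sigma>(1) by (simp add: power_divide right_diff_distrib power2_eq_square power3_eq_cube power4_eq_xxxx)
      ultimately show ?thesis using \<sigma>(1) by simp
    qed
    have "5 / 9 * \<sigma> = 1 / \<sigma> * \<sigma>\<^sup>2 - 4 / (27 * \<sigma> ^ 3) * (3 * (\<sigma>\<^sup>2)\<^sup>2)"
      using \<sigma>(1) by (simp add: field_simps power2_eq_square power3_eq_cube)
    also have "\<dots> \<le> 1 / \<sigma> * sign_mean (\<lambda>s. (norm s)\<^sup>2) a n 0
        - 4 / (27 * \<sigma> ^ 3) * sign_mean (\<lambda>s. (norm s) ^ 4) a n 0"
      using sign_mean_norm_power4[of a n 0] \<sigma>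
      by (intro diff_mono mult_left_mono) (simp_all add: sign_mean_norm_power2 S_def)
    also have "\<dots> = sign_mean (\<lambda>s. 1 / \<sigma> * (norm s)\<^sup>2 - 4 / (27 * \<sigma> ^ 3) * (norm s) ^ 4) a n 0"
      by (rule sign_mean_diff[symmetric])
    also have "\<dots> \<le> sign_mean norm a n 0"
      by (rule sign_mean_mono) (rule pw')
    finally show ?thesis by (simp add: \<sigma>_def S_def)
  qed (simp add: S_def[symmetric] sign_mean_nonneg)
qed

lemma khinchine_Lp:
  fixes a :: "nat \<Rightarrow> 'a::real_normed_field"
  assumes "p \<ge> 1"
  shows "(5 / 9 * sqrt (\<Sum>k<n. (norm (a k))\<^sup>2)) powr p \<le> sign_mean (\<lambda>s. norm s powr p) a n 0"
proof -
  have "(5 / 9 * sqrt (\<Sum>k<n. (norm (a k))\<^sup>2)) powr p \<le> sign_mean norm a n 0 powr p"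
    using assms by (intro powr_mono2 khinchine_L1) (simp_all add: sum_nonneg)
  also have "\<dots> \<le> sign_mean (\<lambda>s. norm s powr p) a n 0"
    using assms by (intro sign_mean_powr) auto
  finally show ?thesis .
qed

section \<open>Comparing power sums with the square function\<close>

text \<open>Each \<open>t k\<close> is at most the Euclidean norm \<open>\<sigma>\<close>, so
  \<open>t k powr p\<close> is at most \<open>(t k)^2 * \<sigma> powr (p - 2)\<close>.\<close>

lemma sum_powr_le_sqrt_powr:
  fixes t :: "nat \<Rightarrow> real"
  assumes "p \<ge> 2" "\<And>k. t k \<ge> 0"
  shows "(\<Sum>k<n. t k powr p) \<le> sqrt (\<Sum>k<n. (t k)\<^sup>2) powr p"
proof -
  define \<sigma> where "\<sigma> = sqrt (\<Sum>k<n. (t k)\<^sup>2)"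
  have "\<sigma> \<ge> 0" by (simp add: \<sigma>_def sum_nonneg)
  have split: "x powr p = x\<^sup>2 * x powr (p - 2)" if "x \<ge> 0" for x :: real
    using that by (cases "x = 0") (simp_all add: powr_diff)
  have "(\<Sum>k<n. t k powr p) \<le> (\<Sum>k<n. (t k)\<^sup>2 * \<sigma> powr (p - 2))"
  proof (rule sum_mono)
    fix k assume "k \<in> {..<n}"
    then have "(t k)\<^sup>2 \<le> (\<Sum>k<n. (t k)\<^sup>2)" by (intro member_le_sum) auto
    then have "t k \<le> \<sigma>" unfolding \<sigma>_def by (rule real_le_rsqrt)
    then show "t k powr p \<le> (t k)\<^sup>2 * \<sigma> powr (p - 2)"
      using assms by (simp add: split mult_left_mono powr_mono2)
  qed
  also have "\<dots> = \<sigma>\<^sup>2 * \<sigma> powr (p - 2)"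
    by (simp add: \<sigma>_def sum_nonneg flip: sum_distrib_right)
  also have "\<dots> = \<sigma> powr p" using split \<open>\<sigma> \<ge> 0\<close> by simp
  finally show ?thesis by (simp add: \<sigma>_def)
qed

text \<open>A coarse form of Young's inequality: both factors are compared with powers of the
  maximum.\<close>

lemma powr_mult_powr_le_add:
  assumes "0 \<le> \<theta>" "\<theta> \<le> 1" "x \<ge> 0" "y \<ge> (0::real)"
  shows "x powr (1 - \<theta>) * y powr \<theta> \<le> x + y"
proof -
  have "x powr (1 - \<theta>) * y powr \<theta> \<le> (max x y) powr (1 - \<theta>) * (max x y) powr \<theta>"
    using assms by (intro mult_mono powr_mono2) auto
  also have "\<dots> = max x y"
    using assms by (simp flip: powr_add)
  finally show ?thesis using assms by linarith
qed

text \<open>Hoelder's inequality with weights, up to a factor 2: after normalising by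
  \<open>S\<close>, the Young-type bound with exponent \<open>p / 2\<close> is summed. Suitable
  weights later recover a sum of squares from sums of \<open>p\<close>-th powers when
  \<open>p < 2\<close>.\<close>

lemma weighted_sum_powr_le_sqrt_powr:
  fixes t w :: "nat \<Rightarrow> real"
  assumes "0 \<le> p" "p \<le> 2" "\<And>k. t k \<ge> 0" "\<And>k. w k \<ge> 0" "(\<Sum>k<n. w k) \<le> 1"
  shows "(\<Sum>k<n. w k powr (1 - p / 2) * t k powr p) \<le> 2 * sqrt (\<Sum>k<n. (t k)\<^sup>2) powr p"
proof -
  define S where "S = (\<Sum>k<n. (t k)\<^sup>2)"
  have "S \<ge> 0" by (simp add: S_def sum_nonneg)
  have sqp: "sqrt S powr p = S powr (p / 2)"
    using \<open>S \<ge> 0\<close> by (simp add: powr_powr flip: powr_half_sqrt)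
  show ?thesis
  proof (cases "S = 0")
    case True
    then have "t k = 0" if "k < n" for k
      using that by (simp add: S_def sum_nonneg_eq_0_iff)
    then have "(\<Sum>k<n. w k powr (1 - p / 2) * t k powr p) = 0" by simp
    then show ?thesis by simp
  next
    case False
    have "(\<Sum>k<n. w k powr (1 - p / 2) * t k powr p)
        \<le> (\<Sum>k<n. S powr (p / 2) * (w k + (t k)\<^sup>2 / S))"
    proof (rule sum_mono)
      fix k
      have "((t k)\<^sup>2) powr (p / 2) = t k powr p"
        using assms(3)[of k] by (cases "t k = 0") (simp_all add: powr_powr flip: powr_numeral)
      then have "w k powr (1 - p / 2) * t k powr p
          = S powr (p / 2) * (w k powr (1 - p / 2) * ((t k)\<^sup>2 / S) powr (p / 2))"
        using \<open>S \<ge> 0\<close> False by (simp add: powr_divide)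
      also have "\<dots> \<le> S powr (p / 2) * (w k + (t k)\<^sup>2 / S)"
        using assms \<open>S \<ge> 0\<close> by (intro mult_left_mono powr_mult_powr_le_add) auto
      finally show "w k powr (1 - p / 2) * t k powr p \<le> S powr (p / 2) * (w k + (t k)\<^sup>2 / S)" .
    qed
    also have "\<dots> = S powr (p / 2) * ((\<Sum>k<n. w k) + S / S)"
      by (simp add: S_def sum.distrib flip: sum_distrib_left sum_divide_distrib)
    also have "\<dots> \<le> S powr (p / 2) * (1 + 1)"
      using assms False by (intro mult_left_mono) auto
    finally show ?thesis by (simp add: sqp flip: S_def)
  qed
qed

section \<open>Weakly summable sequences for exponents at least 1\<close>

lemma lp_space_add:
  assumes "p \<ge> 0" "x \<in> lp_space p" "y \<in> lp_space p"
  shows "(\<lambda>k. x k + y k) \<in> lp_space p"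
proof -
  have le: "norm (x k + y k) powr p \<le> 2 powr p * (norm (x k) powr p + norm (y k) powr p)" for k
  proof -
    define u where "u = max (norm (x k)) (norm (y k))"
    have "norm (x k + y k) \<le> 2 * u"
      using norm_triangle_ineq[of "x k" "y k"] unfolding u_def by linarith
    then have "norm (x k + y k) powr p \<le> (2 * u) powr p"
      using assms by (intro powr_mono2) auto
    also have "\<dots> = 2 powr p * u powr p"
      by (rule powr_mult)
    also have "u powr p \<le> norm (x k) powr p + norm (y k) powr p"
      unfolding u_def max_def by simp
    finally show ?thesis by simp
  qed
  have "summable (\<lambda>k. 2 powr p * (norm (x k) powr p + norm (y k) powr p))"
    using assms by (intro summable_mult summable_add) (simp_all add: lp_space_def)
  then have "summable (\<lambda>k. norm (x k + y k) powr p)"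
    by (rule summable_comparison_test'[where N = 0]) (simp add: le)
  then show ?thesis by (simp add: lp_space_def)
qed

lemma lp_space_scale:
  assumes "x \<in> lp_space p"
  shows "(\<lambda>k. c * x k) \<in> lp_space p"
  using assms by (simp add: lp_space_def norm_mult powr_mult summable_mult)

lemma lp_norm_nonneg: "lp_norm p x \<ge> 0"
  by (simp add: lp_norm_def)

lemma lp_norm_powr:
  assumes "p > 0" "x \<in> lp_space p"
  shows "lp_norm p x powr p = (\<Sum>k. norm (x k) powr p)"
  using assms by (simp add: lp_norm_def lp_space_def powr_powr suminf_nonneg)

lemma sum_powr_le_lp_norm:
  assumes "p > 0" "x \<in> lp_space p"
  shows "(\<Sum>k<n. norm (x k) powr p) \<le> lp_norm p x powr p"
  using assms by (simp add: lp_norm_powr lp_space_def sum_le_suminf)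

lemma norm_le_lp_norm:
  assumes "p > 0" "x \<in> lp_space p"
  shows "norm (x k) \<le> lp_norm p x"
proof -
  have "norm (x k) powr p \<le> (\<Sum>k<Suc k. norm (x k) powr p)"
    by (intro member_le_sum) auto
  also have "\<dots> \<le> lp_norm p x powr p" using assms by (rule sum_powr_le_lp_norm)
  finally have le: "norm (x k) powr p \<le> lp_norm p x powr p" .
  show ?thesis
  proof (rule ccontr)
    assume "\<not> norm (x k) \<le> lp_norm p x"
    then have "lp_norm p x powr p < norm (x k) powr p"
      using assms by (intro powr_less_mono2) (auto simp: lp_norm_nonneg)
    with le show False by simp
  qed
qed

section \<open>Bounded functionals and uniform boundedness\<close>

text \<open>The ball of radius \<open>C\<close> in the dual. The explicit radius replaces the
  operator norm in all estimates; values outside \<open>lp_space p\<close> are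
  unconstrained.\<close>

definition dual_ball :: "real \<Rightarrow> real \<Rightarrow> ((nat \<Rightarrow> 'a::real_normed_field) \<Rightarrow> 'a) set" where
  "dual_ball p C = {f. lin_on_lp p f (+) (*) \<and> (\<forall>x\<in>lp_space p. norm (f x) \<le> C * lp_norm p x)}"

lemma lp_dual_iff_dual_ball: "f \<in> lp_dual p \<longleftrightarrow> (\<exists>C. f \<in> dual_ball p C)"
  by (auto simp: lp_dual_def dual_ball_def)

lemma dual_ballD:
  assumes "f \<in> dual_ball p C" "x \<in> lp_space p"
  shows "norm (f x) \<le> C * lp_norm p x" "f (\<lambda>k. c * x k) = c * f x"
    "y \<in> lp_space p \<Longrightarrow> f (\<lambda>k. x k + y k) = f x + f y"
  using assms by (auto simp: dual_ball_def lin_on_lp_def)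

lemma dual_ball_zero: "C \<ge> 0 \<Longrightarrow> (\<lambda>x. 0) \<in> dual_ball p C"
  by (simp add: dual_ball_def lin_on_lp_def lp_norm_nonneg)

lemma dual_ball_add:
  assumes "f \<in> dual_ball p C" "g \<in> dual_ball p D"
  shows "(\<lambda>x. f x + g x) \<in> dual_ball p (C + D)"
proof -
  have "norm (f x + g x) \<le> (C + D) * lp_norm p x" if "x \<in> lp_space p" for x
    using dual_ballD(1)[OF assms(1) that] dual_ballD(1)[OF assms(2) that]
    by (intro norm_triangle_le) (simp add: distrib_right)
  moreover have "lin_on_lp p (\<lambda>x. f x + g x) (+) (*)"
    using assms by (simp add: dual_ball_def lin_on_lp_def distrib_left)
  ultimately show ?thesis by (simp add: dual_ball_def)
qed

lemma dual_ball_scale: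
  assumes "f \<in> dual_ball p C"
  shows "(\<lambda>x. c * f x) \<in> dual_ball p (norm c * C)"
proof -
  have "norm (c * f x) \<le> norm c * C * lp_norm p x" if "x \<in> lp_space p" for x
    using mult_left_mono[OF dual_ballD(1)[OF assms that], of "norm c"] by (simp add: norm_mult mult.assoc)
  moreover have "lin_on_lp p (\<lambda>x. c * f x) (+) (*)"
    using assms by (simp add: dual_ball_def lin_on_lp_def distrib_left mult.left_commute)
  ultimately show ?thesis by (simp add: dual_ball_def)
qed

lemma dual_ball_closed:
  assumes "p \<ge> 0" "\<And>n. F n \<in> dual_ball p C" "\<And>x. x \<in> lp_space p \<Longrightarrow> (\<lambda>n. F n x) \<longlonglongrightarrow> f x"
  shows "f \<in> dual_ball p C"
proof -
  have "f (\<lambda>k. x k + y k) = f x + f y" if "x \<in> lp_space p" "y \<in> lp_space p" for x y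
  proof (rule LIMSEQ_unique)
    show "(\<lambda>n. F n (\<lambda>k. x k + y k)) \<longlonglongrightarrow> f (\<lambda>k. x k + y k)"
      by (rule assms(3)[OF lp_space_add[OF assms(1) that]])
    show "(\<lambda>n. F n (\<lambda>k. x k + y k)) \<longlonglongrightarrow> f x + f y"
      using tendsto_add[OF assms(3)[OF that(1)] assms(3)[OF that(2)]] dual_ballD(3)[OF assms(2)] that by simp
  qed
  moreover have "f (\<lambda>k. c * x k) = c * f x" if "x \<in> lp_space p" for x c
  proof (rule LIMSEQ_unique)
    show "(\<lambda>n. F n (\<lambda>k. c * x k)) \<longlonglongrightarrow> f (\<lambda>k. c * x k)"
      by (rule assms(3)[OF lp_space_scale[OF that]])
    show "(\<lambda>n. F n (\<lambda>k. c * x k)) \<longlonglongrightarrow> c * f x"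
      using tendsto_mult_left[OF assms(3)[OF that]] dual_ballD(2)[OF assms(2)] that by simp
  qed
  moreover have "norm (f x) \<le> C * lp_norm p x" if "x \<in> lp_space p" for x
    using dual_ballD(1)[OF assms(2) that]
    by (intro LIMSEQ_le_const2[OF tendsto_norm[OF assms(3)[OF that]]]) auto
  ultimately show ?thesis by (simp add: dual_ball_def lin_on_lp_def)
qed

text \<open>A gliding hump argument. If the bound failed, there would be unit functionals
  \<open>F n\<close> with \<open>q (N n) (F n) \<ge> 4 ^ n\<close>, nearly maximal for
  \<open>q (N n)\<close>. The series of the \<open>F n\<close> with coefficients
  \<open>\<plusminus> (1/3)^n\<close> and suitable signs converges to a functional \<open>G\<close>
  on which \<open>q (N n)\<close> grows like \<open>(4/3)^n\<close>, against summability.\<close>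

theorem dual_ball_uniformly_bounded:
  fixes x :: "nat \<Rightarrow> nat \<Rightarrow> 'a::real_normed_field"
  assumes p: "p > 0" and x: "\<And>k. x k \<in> lp_space p"
    and summable: "\<And>f. f \<in> lp_dual p \<Longrightarrow> summable (\<lambda>k. norm (f (x k)))"
  obtains M where "\<And>n f. f \<in> dual_ball p 1 \<Longrightarrow> (\<Sum>k<n. norm (f (x k))) \<le> M"
proof (rule ccontr)
  assume "\<not> thesis"
  define q where "q N f = (\<Sum>k<N. norm (f (x k)))" for N and f :: "(nat \<Rightarrow> 'a) \<Rightarrow> 'a"
  have unbdd: "\<exists>N f. f \<in> dual_ball p 1 \<and> M < q N f" for M
    using \<open>\<not> thesis\<close> that[of M] unfolding q_def by (meson not_le)
  have q_add: "q N (\<lambda>x. f x + g x) \<le> q N f + q N g" for N f g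
    unfolding q_def by (simp add: sum_mono norm_triangle_ineq flip: sum.distrib)
  have q_scale: "q N (\<lambda>x. c * f x) = norm c * q N f" for N f c
    unfolding q_def by (simp add: norm_mult sum_distrib_left)
  \<comment> \<open>The factor 4/3 is chosen for the tail estimate: the tail after step
    \<open>n\<close> has radius \<open>(1/3)^n / 2\<close>, so near maximality costs only two thirds
    of the gain \<open>(1/3)^n * q (N n) (F n)\<close>.\<close>
  have near_max: "\<exists>N f. f \<in> dual_ball p 1 \<and> 4 ^ n \<le> q N f \<and> (\<forall>g\<in>dual_ball p 1. q N g \<le> 4 / 3 * q N f)" for n
  proof -
    obtain N f0 where f0: "f0 \<in> dual_ball p 1" "4 / 3 * 4 ^ n < q N f0"
      using unbdd by blast
    define B where "B = (SUP g\<in>dual_ball p 1. q N g)"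
    \<comment> \<open>For fixed \<open>N\<close> the seminorm \<open>q N\<close> is bounded on the
      unit ball, so a near maximiser exists.\<close>
    have bdd: "bdd_above (q N ` dual_ball p 1)"
    proof (rule bdd_aboveI2)
      fix g :: "(nat \<Rightarrow> 'a) \<Rightarrow> 'a" assume "g \<in> dual_ball p 1"
      then show "q N g \<le> (\<Sum>k<N. lp_norm p (x k))"
        unfolding q_def using dual_ballD(1)[OF _ x] by (intro sum_mono) fastforce
    qed
    have le: "q N g \<le> B" if "g \<in> dual_ball p 1" for g
      unfolding B_def using that bdd by (rule cSUP_upper)
    have "4 / 3 * 4 ^ n < B" using f0 le by fastforce
    moreover have "(0::real) < 4 ^ n" by simp
    ultimately have "3 / 4 * B < B" by linarith
    then obtain f where "f \<in> dual_ball p 1" "3 / 4 * B < q N f"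
      unfolding B_def using less_cSUP_iff[OF _ bdd] f0(1) by blast
    with \<open>4 / 3 * 4 ^ n < B\<close> le show ?thesis by (intro exI[of _ N] exI[of _ f]) force
  qed
  define P where "P n N f \<longleftrightarrow> f \<in> dual_ball p 1 \<and> 4 ^ n \<le> q N f \<and> (\<forall>g\<in>dual_ball p 1. q N g \<le> 4 / 3 * q N f)" for n N f
  have "\<forall>n. \<exists>Nf. P n (fst Nf) (snd Nf)" using near_max by (simp add: P_def)
  then obtain Nf where "\<And>n. P n (fst (Nf n)) (snd (Nf n))"
    using choice[of "\<lambda>n Nf. P n (fst Nf) (snd Nf)"] by blast
  then obtain N F where NF: "\<And>n. P n (N n) (F n)"
    using that[of "\<lambda>n. fst (Nf n)" "\<lambda>n. snd (Nf n)"] by blast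
  then have F: "F n \<in> dual_ball p 1" and q_ge: "4 ^ n \<le> q (N n) (F n)"
    and q_near: "g \<in> dual_ball p 1 \<Longrightarrow> q (N n) g \<le> 4 / 3 * q (N n) (F n)" for n g
    by (auto simp: P_def)
  define c :: "nat \<Rightarrow> 'a" where "c n = of_real ((1 / 3) ^ n)" for n
  have norm_c: "norm (c n) = (1 / 3) ^ n" for n by (simp only: c_def norm_of_real) simp
  \<comment> \<open>Since \<open>q (g + h) + q (g - h) \<ge> 2 q h\<close>, one of the two signs makes the new term survive.\<close>
  define g where "g = rec_nat (\<lambda>x. 0) (\<lambda>n g. let h = (\<lambda>x. g x + c n * F n x) in
     if norm (c n) * q (N n) (F n) \<le> q (N n) h then h else (\<lambda>x. g x + (- c n) * F n x))"
  have g_0: "g 0 = (\<lambda>x. 0)" by (simp add: g_def)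
  have g_Suc: "g (Suc n) = (let h = (\<lambda>x. g n x + c n * F n x) in
     if norm (c n) * q (N n) (F n) \<le> q (N n) h then h else (\<lambda>x. g n x + (- c n) * F n x))" for n
    unfolding g_def by simp
  have g_step: "\<exists>d. norm d = (1 / 3) ^ n \<and> g (Suc n) = (\<lambda>x. g n x + d * F n x)" for n
    unfolding g_Suc Let_def using norm_c[of n]
    by (auto intro: exI[of _ "c n"] exI[of _ "- c n"])
  have g_large: "(1 / 3) ^ n * q (N n) (F n) \<le> q (N n) (g (Suc n))" for n
  proof (cases "norm (c n) * q (N n) (F n) \<le> q (N n) (\<lambda>x. g n x + c n * F n x)")
    case True
    then show ?thesis by (simp add: g_Suc norm_c)
  next
    case False
    have "q (N n) (\<lambda>x. (g n x + c n * F n x) + (- 1) * (g n x + (- c n) * F n x))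
        \<le> q (N n) (\<lambda>x. g n x + c n * F n x) + q (N n) (\<lambda>x. (- 1) * (g n x + (- c n) * F n x))"
      by (rule q_add)
    also have "q (N n) (\<lambda>x. (- 1) * (g n x + (- c n) * F n x)) = q (N n) (\<lambda>x. g n x + (- c n) * F n x)"
      unfolding q_scale by simp
    also have "(\<lambda>x. (g n x + c n * F n x) + (- 1) * (g n x + (- c n) * F n x)) = (\<lambda>x. (2 * c n) * F n x)"
      by (simp add: algebra_simps)
    finally have "2 * (norm (c n) * q (N n) (F n))
        \<le> q (N n) (\<lambda>x. g n x + c n * F n x) + q (N n) (\<lambda>x. g n x + (- c n) * F n x)"
      unfolding q_scale by (simp add: norm_mult)
    with False have "norm (c n) * q (N n) (F n) \<le> q (N n) (\<lambda>x. g n x + (- c n) * F n x)" by linarith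
    with False show ?thesis by (simp add: g_Suc norm_c)
  qed
  \<comment> \<open>The radius is the geometric sum of \<open>(1/3)^i\<close> over
    \<open>n \<le> i < n + k\<close>.\<close>
  have g_diff: "(\<lambda>x. g (n + k) x - g n x) \<in> dual_ball p (3 / 2 * ((1 / 3) ^ n - (1 / 3) ^ (n + k)))" for n k
  proof (induction k)
    case 0
    show ?case using dual_ball_zero[of 0 p] by simp
  next
    case (Suc k)
    obtain d where d: "norm d = (1 / 3) ^ (n + k)" "g (Suc (n + k)) = (\<lambda>x. g (n + k) x + d * F (n + k) x)"
      using g_step by blast
    have "(\<lambda>x. (g (n + k) x - g n x) + d * F (n + k) x)
        \<in> dual_ball p (3 / 2 * ((1 / 3) ^ n - (1 / 3) ^ (n + k)) + norm d * 1)"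
      by (intro dual_ball_add Suc dual_ball_scale F)
    moreover have "3 / 2 * ((1 / 3) ^ n - (1 / 3) ^ (n + k)) + norm d * 1
        = 3 / 2 * ((1 / 3) ^ n - (1 / 3) ^ (n + Suc k) :: real)"
      unfolding d(1) by (simp add: field_simps)
    moreover have "(\<lambda>x. (g (n + k) x - g n x) + d * F (n + k) x) = (\<lambda>x. g (n + Suc k) x - g n x)"
      unfolding add_Suc_right d(2) by (simp add: algebra_simps)
    ultimately show ?case by (simp only:)
  qed
  have mono: "f \<in> dual_ball p D" if "f \<in> dual_ball p C" "C \<le> D" for f :: "(nat \<Rightarrow> 'a) \<Rightarrow> 'a" and C D
    using that mult_right_mono[OF that(2) lp_norm_nonneg]
    unfolding dual_ball_def by (blast intro: order.trans)
  have g_diff': "(\<lambda>x. g (n + k) x - g n x) \<in> dual_ball p (3 / 2 * (1 / 3) ^ n)" for n k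
    by (rule mono[OF g_diff]) (simp add: algebra_simps)
  have conv: "convergent (\<lambda>n. g n y)" if y: "y \<in> lp_space p" for y
  \<comment> \<open>Completeness of the scalars, provided by the classification, is what makes the
    pointwise limit exist.\<close>
  proof (intro real_normed_field_complete CauchyI')
    fix e :: real assume "e > 0"
    have "(\<lambda>n. 3 / 2 * (1 / 3) ^ n * lp_norm p y) \<longlonglongrightarrow> 3 / 2 * 0 * lp_norm p y"
      by (intro tendsto_intros LIMSEQ_realpow_zero) auto
    then have "\<forall>\<^sub>F n in sequentially. 3 / 2 * (1 / 3) ^ n * lp_norm p y < e"
      using \<open>e > 0\<close> by (intro order_tendstoD(2)) auto
    then obtain n0 where n0: "\<And>n. n \<ge> n0 \<Longrightarrow> 3 / 2 * (1 / 3) ^ n * lp_norm p y < e"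
      by (auto simp: eventually_sequentially)
    show "\<exists>M. \<forall>m\<ge>M. \<forall>n>m. dist (g m y) (g n y) < e"
    proof (intro exI[of _ n0] allI impI)
      fix m n assume mn: "m \<ge> n0" "n > m"
      have "norm (g (m + (n - m)) y - g m y) \<le> 3 / 2 * (1 / 3) ^ m * lp_norm p y"
        by (rule dual_ballD(1)[OF g_diff' y])
      with n0[OF mn(1)] mn(2) show "dist (g m y) (g n y) < e"
        by (simp add: dist_norm norm_minus_commute)
    qed
  qed
  define G where "G y = lim (\<lambda>n. g n y)" for y
  have G: "(\<lambda>n. g n y) \<longlonglongrightarrow> G y" if "y \<in> lp_space p" for y
    unfolding G_def using conv[OF that] by (simp add: convergent_LIMSEQ_iff)
  have tail: "(\<lambda>y. G y - g n y) \<in> dual_ball p (3 / 2 * (1 / 3) ^ n)" for n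
  proof (rule dual_ball_closed[where F = "\<lambda>k x. g (n + k) x - g n x"])
    show "(\<lambda>k. g (n + k) y - g n y) \<longlonglongrightarrow> G y - g n y" if "y \<in> lp_space p" for y
      using LIMSEQ_ignore_initial_segment[OF G[OF that], of n]
      by (intro tendsto_intros) (simp add: add.commute)
  qed (use p g_diff' in auto)
  have "G \<in> lp_dual p"
    using tail[of 0] by (auto simp: g_0 lp_dual_iff_dual_ball)
  then have "summable (\<lambda>k. norm (G (x k)))" by (rule summable)
  then have q_G: "q n G \<le> (\<Sum>k. norm (G (x k)))" for n
    unfolding q_def by (intro sum_le_suminf) auto
  have lower: "1 / 3 * (4 / 3) ^ n \<le> q (N n) G" for n
  proof -
    define t :: real where "t = 3 / 2 * (1 / 3) ^ Suc n"
    have "t > 0" by (simp add: t_def)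
    \<comment> \<open>The tail is rescaled into the unit ball so that near maximality of
      \<open>F n\<close> applies to it.\<close>
    have "(\<lambda>y. of_real (1 / t) * (G y - g (Suc n) y)) \<in> dual_ball p (norm (of_real (1 / t) :: 'a) * t)"
      using tail[of "Suc n"] unfolding t_def by (rule dual_ball_scale)
    then have "(\<lambda>y. of_real (1 / t) * (G y - g (Suc n) y)) \<in> dual_ball p 1"
      using \<open>t > 0\<close> unfolding norm_of_real by simp
    then have "norm (of_real (1 / t) :: 'a) * q (N n) (\<lambda>y. G y - g (Suc n) y) \<le> 4 / 3 * q (N n) (F n)"
      unfolding q_scale[symmetric] by (rule q_near)
    then have "q (N n) (\<lambda>y. G y - g (Suc n) y) \<le> t * (4 / 3 * q (N n) (F n))"
      using \<open>t > 0\<close> unfolding norm_of_real by (simp add: field_simps)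
    moreover have "q (N n) (g (Suc n)) \<le> q (N n) G + q (N n) (\<lambda>y. G y - g (Suc n) y)"
      using q_add[of "N n" G "\<lambda>y. (-1) * (G y - g (Suc n) y)"]
      unfolding q_scale by (simp add: algebra_simps)
    ultimately have "(1 / 3) ^ n * q (N n) (F n) \<le> q (N n) G + t * (4 / 3 * q (N n) (F n))"
      using g_large[of n] by linarith
    then have "1 / 3 * ((1 / 3) ^ n * q (N n) (F n)) \<le> q (N n) G"
      by (simp add: t_def algebra_simps)
    moreover have "(1 / 3) ^ n * 4 ^ n \<le> (1 / 3) ^ n * q (N n) (F n)"
      using q_ge by (intro mult_left_mono) auto
    moreover have "(1 / 3) ^ n * 4 ^ n = (4 / 3 :: real) ^ n"
      by (simp flip: power_mult_distrib)
    ultimately show ?thesis by linarith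
  qed
  obtain n where "3 * (\<Sum>k. norm (G (x k))) < (4 / 3) ^ n"
    using real_arch_pow[of "4 / 3"] by auto
  with lower[of n] q_G[of "N n"] show False by linarith
qed

text \<open>The norming functional of the first \<open>J\<close> coordinates, with a cruder constant than
  the one given by Hoelder's inequality.\<close>
lemma sum_powr_le_of_dual_ball:
  fixes y :: "nat \<Rightarrow> 'a::real_normed_field"
  assumes p: "p \<ge> 1" and M: "\<And>f. f \<in> dual_ball p 1 \<Longrightarrow> norm (f y) \<le> M"
  shows "(\<Sum>j<J. norm (y j) powr p) \<le> (2 * M) powr p"
proof -
  define S where "S = (\<Sum>j<J. norm (y j) powr p)"
  have "S \<ge> 0" by (simp add: S_def sum_nonneg)
  show ?thesis
  proof (cases "S = 0")
    case False
    define Y where "Y = S powr (1 / p)"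
    have Y: "Y > 0" "Y powr p = S"
      using p False \<open>S \<ge> 0\<close> by (simp_all add: Y_def powr_powr)
    define \<beta> where "\<beta> j = norm (y j) / Y" for j
    have \<beta>: "\<beta> j \<ge> 0" for j using Y by (simp add: \<beta>_def)
    have sum_\<beta>: "(\<Sum>j<J. \<beta> j powr p) = 1"
      using Y False \<open>S \<ge> 0\<close> unfolding \<beta>_def by (simp add: powr_divide S_def flip: sum_divide_distrib)
    \<comment> \<open>For \<open>y j \<noteq> 0\<close> this has norm
      \<open>\<beta> j powr (p - 1)\<close> and makes \<open>b j * y j\<close> a nonnegative real;
      for \<open>y j = 0\<close> division by zero gives \<open>b j = 0\<close>.\<close>
    define b where "b j = of_real (\<beta> j powr p * Y) / y j" for j
    \<comment> \<open>The factor 1/2 offsets the constant 2 lost in the Young-type bound and is the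
      source of the 2 in \<open>2 * M\<close>.\<close>
    define f where "f = (\<lambda>u. of_real (1 / 2) * (\<Sum>j<J. b j * u j))"
    have "norm (\<Sum>j<J. b j * u j) \<le> 2 * lp_norm p u" if u: "u \<in> lp_space p" for u
    proof (cases "lp_norm p u = 0")
      case True
      then have "u j = 0" for j using norm_le_lp_norm[OF _ u, of j] p by simp
      with True show ?thesis by simp
    next
      case False
      define U where "U = lp_norm p u"
      have "U > 0" using False lp_norm_nonneg[of p u] by (simp add: U_def)
      define \<xi> where "\<xi> j = norm (u j) / U" for j
      have \<xi>: "\<xi> j \<ge> 0" for j using \<open>U > 0\<close> by (simp add: \<xi>_def)
      have "(\<Sum>j<J. \<xi> j powr p) = (\<Sum>j<J. norm (u j) powr p) / U powr p"
        using \<open>U > 0\<close> by (simp add: \<xi>_def powr_divide sum_divide_distrib)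
      also have "\<dots> \<le> 1"
        using sum_powr_le_lp_norm[OF _ u, of J] p \<open>U > 0\<close> by (simp add: U_def)
      finally have sum_\<xi>: "(\<Sum>j<J. \<xi> j powr p) \<le> 1" .
      have "norm (b j * u j) \<le> U * (\<beta> j powr p + \<xi> j powr p)" for j
      proof (cases "y j = 0")
        case True
        then show ?thesis using \<open>U > 0\<close> by (simp add: b_def)
      next
        case False
        then have "\<beta> j > 0" using Y by (simp add: \<beta>_def)
        have "norm (b j * u j) = U * (\<beta> j powr (p - 1) * \<xi> j)"
          using False Y \<open>U > 0\<close> \<open>\<beta> j > 0\<close>
          by (simp add: b_def \<xi>_def norm_mult norm_divide powr_diff) (simp add: \<beta>_def)
        also have "\<beta> j powr (p - 1) * \<xi> j = (\<beta> j powr p) powr (1 - 1 / p) * (\<xi> j powr p) powr (1 / p)"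
          using p \<xi>[of j] by (simp add: powr_powr algebra_simps)
        also have "\<dots> \<le> \<beta> j powr p + \<xi> j powr p"
          using p by (intro powr_mult_powr_le_add) auto
        finally show ?thesis using \<open>U > 0\<close> by simp
      qed
      then have "norm (\<Sum>j<J. b j * u j) \<le> (\<Sum>j<J. U * (\<beta> j powr p + \<xi> j powr p))"
        by (intro order.trans[OF norm_sum] sum_mono)
      also have "\<dots> = U * ((\<Sum>j<J. \<beta> j powr p) + (\<Sum>j<J. \<xi> j powr p))"
        by (simp add: sum.distrib flip: sum_distrib_left)
      also have "\<dots> \<le> U * 2" using sum_\<beta> sum_\<xi> \<open>U > 0\<close> by (intro mult_left_mono) auto
      finally show ?thesis by (simp add: U_def)
    qed
    then have "norm (f u) \<le> 1 * lp_norm p u" if "u \<in> lp_space p" for u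
      using that unfolding f_def norm_mult norm_of_real by fastforce
    moreover have "lin_on_lp p f (+) (*)"
      unfolding lin_on_lp_def f_def
      by (simp add: distrib_left sum.distrib sum_distrib_left mult.left_commute add_divide_distrib)
    ultimately have "f \<in> dual_ball p 1" by (simp add: dual_ball_def)
    then have "norm (f y) \<le> M" by (rule M)
    moreover have "f y = of_real (Y / 2)"
    proof -
      have "b j * y j = of_real (\<beta> j powr p * Y)" for j
        by (cases "y j = 0") (simp_all add: b_def \<beta>_def)
      then have "(\<Sum>j<J. b j * y j) = of_real ((\<Sum>j<J. \<beta> j powr p) * Y)"
        by (simp add: sum_distrib_right)
      then show ?thesis by (simp add: f_def sum_\<beta>)
    qed
    ultimately have "Y \<le> 2 * M" using Y(1) by (simp only: norm_of_real)
    then have "Y powr p \<le> (2 * M) powr p" using p Y(1) by (intro powr_mono2) auto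
    then show ?thesis by (simp add: Y(2) S_def)
  qed (simp add: S_def[symmetric])
qed

section \<open>The Orlicz property\<close>

text \<open>Turns a bound on the sums of \<open>norm (f (x k))\<close> into a bound on all signed
  sums that is uniform in the signs.\<close>

lemma dual_ball_sign_sum:
  fixes x :: "nat \<Rightarrow> nat \<Rightarrow> 'a::real_normed_field"
  assumes "p \<ge> 0" "f \<in> dual_ball p C" and x: "\<And>k. x k \<in> lp_space p"
  shows "(\<Sum>k<n. if \<epsilon> k then x k else - x k) \<in> lp_space p \<and>
    norm (f (\<Sum>k<n. if \<epsilon> k then x k else - x k)) \<le> (\<Sum>k<n. norm (f (x k)))"
proof (induction n)
  case 0
  have "f (\<lambda>j. 0 * x 0 j) = 0 * f (x 0)" by (rule dual_ballD(2)[OF assms(2) x])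
  then have "f 0 = 0" by (simp add: zero_fun_def)
  moreover have "0 \<in> lp_space p" by (simp add: lp_space_def)
  ultimately show ?case by (simp del: zero_fun_apply)
next
  case (Suc n)
  define s where "s = (\<Sum>k<n. if \<epsilon> k then x k else - x k)"
  define d :: 'a where "d = (if \<epsilon> n then 1 else - 1)"
  have eq: "(\<Sum>k<Suc n. if \<epsilon> k then x k else - x k) = (\<lambda>j. s j + d * x n j)"
    by (auto simp: s_def d_def)
  have dx: "(\<lambda>j. d * x n j) \<in> lp_space p" "f (\<lambda>j. d * x n j) = d * f (x n)"
    using x assms(2) by (auto intro: lp_space_scale dual_ballD)
  have s: "s \<in> lp_space p" "norm (f s) \<le> (\<Sum>k<n. norm (f (x k)))"
    using Suc by (simp_all add: s_def)
  have "norm (f (\<lambda>j. s j + d * x n j)) \<le> norm (f s) + norm (d * f (x n))"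
    using dual_ballD(3)[OF assms(2) s(1) dx(1)] dx(2) by (simp add: norm_triangle_ineq)
  also have "norm (d * f (x n)) = norm (f (x n))" by (simp add: d_def)
  finally show ?case unfolding eq using s dx assms(1) by (auto intro: lp_space_add)
qed

text \<open>Signed sums are bounded in norm, so their average is too; Khinchine's inequality in each
  coordinate then bounds the \<open>p\<close>-th powers of the square functions
  \<open>\<sigma> n j\<close>, summed over \<open>j\<close>. For \<open>p \<ge> 2\<close> this
  dominates the sum of the \<open>p\<close>-th powers of the norms, and for \<open>p < 2\<close> a
  weighted sum that yields the squares.\<close>

theorem summable_lp_norm_powr:
  fixes x :: "nat \<Rightarrow> nat \<Rightarrow> 'a::real_normed_field"
  assumes p: "p \<ge> 1" and x: "\<And>k. x k \<in> lp_space p"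
    and summable: "\<And>f. f \<in> lp_dual p \<Longrightarrow> summable (\<lambda>k. norm (f (x k)))"
  shows "summable (\<lambda>k. lp_norm p (x k) powr max 2 p)"
proof -
  have "p > 0" using p by simp
  obtain M where M: "\<And>n f. f \<in> dual_ball p 1 \<Longrightarrow> (\<Sum>k<n. norm (f (x k))) \<le> M"
    using dual_ball_uniformly_bounded[of p x] \<open>p > 0\<close> x summable by blast
  define \<sigma> where "\<sigma> n j = sqrt (\<Sum>k<n. (norm (x k j))\<^sup>2)" for n j
  define W where "W = (9 / 5) powr p * (2 * M) powr p"
  have "W \<ge> 0" by (simp add: W_def)
  have W: "(\<Sum>j<J. \<sigma> n j powr p) \<le> W" for n J
  proof -
    have "(\<Sum>j<J. (5 / 9 * \<sigma> n j) powr p) \<le> (\<Sum>j<J. sign_mean (\<lambda>s. norm s powr p) (\<lambda>k. x k j) n 0)"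
      unfolding \<sigma>_def by (intro sum_mono khinchine_Lp p)
    also have "\<dots> = sign_mean (\<lambda>s. \<Sum>j<J. norm (s j) powr p) x n 0"
      using sign_mean_sum_coords[of "\<lambda>s. norm s powr p" "{..<J}" x n 0] by simp
    also have "\<dots> \<le> (2 * M) powr p"
    proof (intro sign_mean_le sum_powr_le_of_dual_ball p)
      fix \<epsilon> :: "nat \<Rightarrow> bool" and f :: "(nat \<Rightarrow> 'a) \<Rightarrow> 'a"
      assume f: "f \<in> dual_ball p 1"
      show "norm (f (0 + (\<Sum>k<n. if \<epsilon> k then x k else - x k))) \<le> M"
        using dual_ball_sign_sum[OF _ f x] M[OF f, of n] p by (fastforce intro: order.trans)
    qed
    finally have "(9 / 5) powr p * (\<Sum>j<J. (5 / 9 * \<sigma> n j) powr p) \<le> W"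
      unfolding W_def by (intro mult_left_mono) auto
    moreover have "(9 / 5) powr p * (5 / 9 * \<sigma> n j) powr p = \<sigma> n j powr p" for j
      by (simp add: \<sigma>_def sum_nonneg flip: powr_mult)
    ultimately show ?thesis by (simp add: sum_distrib_left)
  qed
  \<comment> \<open>A bound uniform over the first \<open>J\<close> coordinates passes to the norms
    by exchanging the finite sums and letting \<open>J\<close> tend to infinity. The weights
    \<open>w\<close> allow its use in both cases.\<close>
  have lim: "(\<Sum>k<n. w k * lp_norm p (x k) powr p) \<le> D"
    if "\<And>J. (\<Sum>j<J. \<Sum>k<n. w k * norm (x k j) powr p) \<le> D" for w n D
  proof (rule LIMSEQ_le_const2)
    have "(\<lambda>J. \<Sum>j<J. norm (x k j) powr p) \<longlonglongrightarrow> lp_norm p (x k) powr p" for k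
      using x[of k] unfolding lp_norm_powr[OF \<open>p > 0\<close> x] by (simp add: lp_space_def summable_LIMSEQ)
    then show "(\<lambda>J. \<Sum>k<n. w k * (\<Sum>j<J. norm (x k j) powr p)) \<longlonglongrightarrow> (\<Sum>k<n. w k * lp_norm p (x k) powr p)"
      by (intro tendsto_intros)
    have "(\<Sum>k<n. w k * (\<Sum>j<J. norm (x k j) powr p)) \<le> D" for J
      using that[of J] by (subst (asm) sum.swap) (simp add: sum_distrib_left)
    then show "\<exists>J0. \<forall>J\<ge>J0. (\<Sum>k<n. w k * (\<Sum>j<J. norm (x k j) powr p)) \<le> D" by blast
  qed
  have "\<exists>D. \<forall>n. (\<Sum>k<n. lp_norm p (x k) powr max 2 p) \<le> D"
  proof (cases "p \<ge> 2")
    case True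
    have "(\<Sum>k<n. 1 * lp_norm p (x k) powr p) \<le> W" for n
    proof (rule lim)
      fix J
      have "(\<Sum>j<J. \<Sum>k<n. norm (x k j) powr p) \<le> (\<Sum>j<J. \<sigma> n j powr p)"
        unfolding \<sigma>_def using True by (intro sum_mono sum_powr_le_sqrt_powr) auto
      with W show "(\<Sum>j<J. \<Sum>k<n. 1 * norm (x k j) powr p) \<le> W" by (fastforce intro: order.trans)
    qed
    with True show ?thesis by (auto simp: max_def)
  next
    case False
    have "(\<Sum>k<n. (lp_norm p (x k))\<^sup>2) \<le> (2 * W) powr (2 / p)" for n
    proof -
      define S where "S = (\<Sum>k<n. (lp_norm p (x k))\<^sup>2)"
      \<comment> \<open>These weights sum to 1 and are extremal for Hoelder's inequality: they turn
        the weighted sum of \<open>p\<close>-th powers into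
        \<open>S / S powr (1 - p / 2) = S powr (p / 2)\<close>.\<close>
      define w where "w k = (lp_norm p (x k))\<^sup>2 / S" for k
      have "S \<ge> 0" by (simp add: S_def sum_nonneg)
      show ?thesis
      proof (cases "S = 0")
        case False
        with \<open>S \<ge> 0\<close> have "S > 0" by simp
        have "(\<Sum>k<n. w k) = 1"
          using False by (simp add: w_def S_def flip: sum_divide_distrib)
        have "(\<Sum>k<n. w k powr (1 - p / 2) * lp_norm p (x k) powr p) \<le> 2 * W"
        proof (rule lim)
          fix J
          have "(\<Sum>j<J. \<Sum>k<n. w k powr (1 - p / 2) * norm (x k j) powr p) \<le> (\<Sum>j<J. 2 * \<sigma> n j powr p)"
            unfolding \<sigma>_def
            using \<open>\<not> p \<ge> 2\<close> p \<open>(\<Sum>k<n. w k) = 1\<close> \<open>S > 0\<close>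
            by (intro sum_mono weighted_sum_powr_le_sqrt_powr) (auto simp: w_def)
          also have "\<dots> \<le> 2 * W" using W[where J = J and n = n] by (simp flip: sum_distrib_left)
          finally show "(\<Sum>j<J. \<Sum>k<n. w k powr (1 - p / 2) * norm (x k j) powr p) \<le> 2 * W" .
        qed
        moreover have "w k powr (1 - p / 2) * lp_norm p (x k) powr p
            = (lp_norm p (x k))\<^sup>2 / S powr (1 - p / 2)" for k
        proof (cases "lp_norm p (x k) = 0")
          case False
          then have pos: "lp_norm p (x k) > 0" using lp_norm_nonneg[of p "x k"] by simp
          have "((lp_norm p (x k))\<^sup>2) powr (1 - p / 2) = lp_norm p (x k) powr (2 - p)"
            using pos by (simp add: powr_powr algebra_simps flip: powr_numeral)
          then have "((lp_norm p (x k))\<^sup>2) powr (1 - p / 2) * lp_norm p (x k) powr p = (lp_norm p (x k))\<^sup>2"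
            using pos by (simp flip: powr_add)
          then show ?thesis using \<open>S > 0\<close> by (simp add: w_def powr_divide)
        qed (use p in simp)
        ultimately have "S / S powr (1 - p / 2) \<le> 2 * W"
          by (simp add: S_def flip: sum_divide_distrib)
        moreover have "S / S powr (1 - p / 2) = S powr (p / 2)"
          using \<open>S > 0\<close> by (simp add: powr_diff)
        ultimately have "(S powr (p / 2)) powr (2 / p) \<le> (2 * W) powr (2 / p)"
          using p by (intro powr_mono2) auto
        then show ?thesis using p \<open>S > 0\<close> by (simp add: powr_powr S_def)
      qed (simp add: S_def)
    qed
    then have "(\<Sum>k<n. lp_norm p (x k) powr 2) \<le> (2 * W) powr (2 / p)" for n
      by (simp add: lp_norm_nonneg)
    with False show ?thesis by (auto simp: max_def)
  qed
  then show ?thesis by (metis summableI_nonneg_bounded powr_ge_zero)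
qed

corollary bounded_ops_abs_summing:
  fixes T :: "(nat \<Rightarrow> 'a::real_normed_field) \<Rightarrow> (nat \<Rightarrow> 'a)"
  assumes p: "p \<ge> 1" and T: "T \<in> bounded_ops p"
  shows "abs_summing p (max 2 p) 1 T"
  unfolding abs_summing_def
proof (intro allI impI)
  fix x :: "nat \<Rightarrow> nat \<Rightarrow> 'a"
  assume x: "\<forall>k. x k \<in> lp_space p" "\<forall>f\<in>lp_dual p. summable (\<lambda>k. norm (f (x k)) powr 1)"
  obtain C where C: "\<And>x. x \<in> lp_space p \<Longrightarrow> lp_norm p (T x) \<le> C * lp_norm p x"
    using T by (auto simp: bounded_ops_def)
  have "summable (\<lambda>k. lp_norm p (x k) powr max 2 p)"
    using x by (intro summable_lp_norm_powr p) auto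
  then have sum: "summable (\<lambda>k. \<bar>C\<bar> powr max 2 p * lp_norm p (x k) powr max 2 p)"
    by (rule summable_mult)
  have le: "lp_norm p (T (x k)) powr max 2 p \<le> \<bar>C\<bar> powr max 2 p * lp_norm p (x k) powr max 2 p" for k
  proof -
    have "lp_norm p (T (x k)) \<le> \<bar>C\<bar> * lp_norm p (x k)"
      using C[of "x k"] x(1) mult_right_mono[OF abs_ge_self[of C] lp_norm_nonneg[of p "x k"]]
      by (meson order.trans)
    then have "lp_norm p (T (x k)) powr max 2 p \<le> (\<bar>C\<bar> * lp_norm p (x k)) powr max 2 p"
      using p by (intro powr_mono2 lp_norm_nonneg) auto
    then show ?thesis by (simp add: powr_mult lp_norm_nonneg)
  qed
  show "summable (\<lambda>k. lp_norm p (T (x k)) powr max 2 p)"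
    by (rule summable_comparison_test'[OF sum, where N = 0]) (simp add: le)
qed

section \<open>Block multipliers for exponents below 1\<close>

lemma lp_norm_le_iff:
  assumes "p > 0" "x \<in> lp_space p" "C \<ge> 0"
  shows "lp_norm p x \<le> C \<longleftrightarrow> (\<Sum>k. norm (x k) powr p) \<le> C powr p"
proof -
  have S: "0 \<le> (\<Sum>k. norm (x k) powr p)"
    using assms by (intro suminf_nonneg) (auto simp: lp_space_def)
  have C: "(C powr p) powr (1 / p) = C" "((\<Sum>k. norm (x k) powr p) powr (1 / p)) powr p = (\<Sum>k. norm (x k) powr p)"
    using assms S by (simp_all add: powr_powr)
  show ?thesis
  proof
    assume "lp_norm p x \<le> C"
    then show "(\<Sum>k. norm (x k) powr p) \<le> C powr p"
      using assms powr_mono2[of p "lp_norm p x" C] unfolding lp_norm_def C by simp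
  next
    assume "(\<Sum>k. norm (x k) powr p) \<le> C powr p"
    then show "lp_norm p x \<le> C"
      using assms S powr_mono2[of "1 / p" "\<Sum>k. norm (x k) powr p" "C powr p"] unfolding lp_norm_def C by simp
  qed
qed

lemma finite_support_lp:
  assumes "p > 0" "finite I" "\<And>j. j \<notin> I \<Longrightarrow> x j = 0"
  shows "x \<in> lp_space p" "lp_norm p x = (\<Sum>j\<in>I. norm (x j) powr p) powr (1 / p)"
proof -
  have "(\<lambda>j. norm (x j) powr p) sums (\<Sum>j\<in>I. norm (x j) powr p)"
    using assms by (intro sums_finite) auto
  then show "x \<in> lp_space p" "lp_norm p x = (\<Sum>j\<in>I. norm (x j) powr p) powr (1 / p)"
    by (auto simp: lp_space_def lp_norm_def sums_iff)
qed

text \<open>Pairing splits the coordinates into infinitely many infinite blocks, indexed by the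
  first component; \<open>m k\<close> multiplies block \<open>k\<close>. Setting the value to 0
  outside the space matches the normalisation in \<open>bounded_ops\<close>.\<close>

definition block_mult :: "real \<Rightarrow> (nat \<Rightarrow> 'a) \<Rightarrow> (nat \<Rightarrow> 'a::real_normed_field) \<Rightarrow> nat \<Rightarrow> 'a" where
  "block_mult p m x = (\<lambda>j. if x \<in> lp_space p then m (fst (prod_decode j)) * x j else 0)"

lemma block_mult_in_bounded_ops:
  assumes p: "p > 0" and m: "\<And>k. norm (m k) \<le> K"
  shows "block_mult p m \<in> bounded_ops p"
proof -
  have "K \<ge> 0" using m[of 0] norm_ge_zero order.trans by blast
  have *: "block_mult p m x \<in> lp_space p \<and> lp_norm p (block_mult p m x) \<le> K * lp_norm p x"
    if x: "x \<in> lp_space p" for x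
  proof -
    have le: "norm (block_mult p m x j) powr p \<le> K powr p * norm (x j) powr p" for j
    proof -
      have "norm (block_mult p m x j) \<le> K * norm (x j)"
        using x m[of "fst (prod_decode j)"] by (simp add: block_mult_def norm_mult mult_right_mono)
      then have "norm (block_mult p m x j) powr p \<le> (K * norm (x j)) powr p"
        using p by (intro powr_mono2) auto
      then show ?thesis using \<open>K \<ge> 0\<close> by (simp add: powr_mult)
    qed
    have sx: "summable (\<lambda>j. norm (x j) powr p)" using x by (simp add: lp_space_def)
    have sK: "summable (\<lambda>j. K powr p * norm (x j) powr p)" by (rule summable_mult[OF sx])
    have s: "summable (\<lambda>j. norm (block_mult p m x j) powr p)"
      by (rule summable_comparison_test'[OF sK, where N = 0]) (simp add: le)
    then have mem: "block_mult p m x \<in> lp_space p" by (simp add: lp_space_def)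
    have "(\<Sum>j. norm (block_mult p m x j) powr p) \<le> (\<Sum>j. K powr p * norm (x j) powr p)"
      by (rule suminf_le[OF le s sK])
    also have "\<dots> = K powr p * (\<Sum>j. norm (x j) powr p)"
      by (rule suminf_mult[OF sx])
    also have "\<dots> \<le> K powr p * lp_norm p x powr p"
      using lp_norm_le_iff[OF p x lp_norm_nonneg[of p x]] by (intro mult_left_mono) auto
    also have "\<dots> = (K * lp_norm p x) powr p"
      by (simp add: powr_mult \<open>K \<ge> 0\<close> lp_norm_nonneg)
    finally have "lp_norm p (block_mult p m x) \<le> K * lp_norm p x"
      using p mem \<open>K \<ge> 0\<close> by (simp add: lp_norm_le_iff lp_norm_nonneg)
    with mem show ?thesis by blast
  qed
  have "lin_on_lp p (block_mult p m) (\<lambda>y z k. y k + z k) (\<lambda>c y k. c * y k)"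
    using p unfolding lin_on_lp_def block_mult_def
    by (auto simp: lp_space_add lp_space_scale algebra_simps)
  with * show ?thesis
    unfolding bounded_ops_def mem_Collect_eq by (auto simp: block_mult_def)
qed

text \<open>There are \<open>2 ^ k\<close> equal entries in block \<open>k\<close>, scaled to make
  the \<open>p\<close>-norm 1. The sum of their absolute values is
  \<open>2 powr (k * (1 - 1/p))\<close>, which decays exactly when \<open>p < 1\<close>.\<close>

definition block_vec :: "real \<Rightarrow> nat \<Rightarrow> nat \<Rightarrow> 'a::real_normed_field" where
  "block_vec p k = (\<lambda>j. if j \<in> (\<lambda>i. prod_encode (k, i)) ` {..<2 ^ k} then of_real (2 powr (- real k / p)) else 0)"

lemma card_block: "card ((\<lambda>i. prod_encode (k, i)) ` {..<2 ^ k}) = 2 ^ k"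
  by (subst card_image) (auto simp: inj_on_def)

lemma block_vec_lp:
  assumes "p > 0"
  shows "block_vec p k \<in> lp_space p" "lp_norm p (\<lambda>j. c * block_vec p k j) = norm c"
proof -
  let ?I = "(\<lambda>i. prod_encode (k, i)) ` {..<2 ^ k}"
  show "block_vec p k \<in> lp_space p"
    by (rule finite_support_lp[OF assms, of ?I]) (auto simp: block_vec_def)
  have "lp_norm p (\<lambda>j. c * block_vec p k j) = (\<Sum>j\<in>?I. norm (c * block_vec p k j) powr p) powr (1 / p)"
    by (rule finite_support_lp[OF assms]) (auto simp: block_vec_def)
  also have "(\<Sum>j\<in>?I. norm (c * block_vec p k j) powr p) = (\<Sum>j\<in>?I. norm c powr p * 2 powr (- real k))"
  proof (rule sum.cong[OF refl])
    fix j assume "j \<in> ?I"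
    then have "norm (c * block_vec p k j) = norm c * 2 powr (- real k / p)"
      unfolding block_vec_def norm_mult by (simp only: if_True norm_of_real) simp
    then show "norm (c * block_vec p k j) powr p = norm c powr p * 2 powr (- real k)"
      using assms by (simp add: powr_mult powr_powr)
  qed
  also have "\<dots> = norm c powr p"
    by (simp add: card_block powr_minus powr_realpow)
  also have "\<dots> powr (1 / p) = norm c"
    using assms by (simp add: powr_powr)
  finally show "lp_norm p (\<lambda>j. c * block_vec p k j) = norm c" .
qed

lemma block_mult_block_vec:
  "p > 0 \<Longrightarrow> block_mult p m (block_vec p k) = (\<lambda>j. m k * block_vec p k j)"
  by (simp add: block_mult_def block_vec_lp(1)) (auto simp: block_vec_def fun_eq_iff)

text \<open>Splitting into single coordinates shows that a bounded functional is controlled by the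
  sum of absolute values, even though the triangle inequality fails for \<open>lp_norm p\<close>
  when \<open>p < 1\<close>.\<close>

lemma dual_norm_finite_indicator:
  fixes f :: "(nat \<Rightarrow> 'a::real_normed_field) \<Rightarrow> 'a"
  assumes p: "p > 0" and lin: "lin_on_lp p f (+) (*)"
    and C: "\<And>x. x \<in> lp_space p \<Longrightarrow> norm (f x) \<le> C * lp_norm p x" and "finite I"
  shows "norm (f (\<lambda>j. if j \<in> I then d else 0)) \<le> real (card I) * (C * norm d)"
  using \<open>finite I\<close>
proof (induction I)
  case empty
  have "(\<lambda>j. 0) \<in> (lp_space p :: (nat \<Rightarrow> 'a) set)" by (simp add: lp_space_def)
  from C[OF this] show ?case by (simp add: lp_norm_def)
next
  case (insert i I)
  let ?x = "\<lambda>j. if j \<in> I then d else 0" and ?e = "\<lambda>j. if j = i then d else 0"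
  have x: "?x \<in> lp_space p"
    by (rule finite_support_lp[OF p insert(1)]) auto
  have e: "?e \<in> lp_space p" "lp_norm p ?e = (\<Sum>j\<in>{i}. norm (?e j) powr p) powr (1 / p)"
    by (rule finite_support_lp[OF p, of "{i}"]; simp)+
  then have ne: "lp_norm p ?e = norm d" using p by (simp add: powr_powr)
  have "(\<lambda>j. if j \<in> insert i I then d else 0) = (\<lambda>j. ?x j + ?e j)"
    using insert(2) by auto
  then have "f (\<lambda>j. if j \<in> insert i I then d else 0) = f ?x + f ?e"
    using lin x e(1) unfolding lin_on_lp_def by simp
  also have "norm \<dots> \<le> real (card I) * (C * norm d) + C * norm d"
    using insert.IH C[OF e(1)] ne by (intro norm_triangle_le add_mono) simp_all
  finally show ?case using insert by (simp add: algebra_simps)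
qed

lemma block_vec_weakly_summable:
  fixes f :: "(nat \<Rightarrow> 'a::real_normed_field) \<Rightarrow> 'a"
  assumes p: "0 < p" "p < 1" and "s > 0" and f: "f \<in> lp_dual p"
  shows "summable (\<lambda>k. norm (f (block_vec p k)) powr s)"
proof -
  obtain C where lin: "lin_on_lp p f (+) (*)" and C: "\<And>x. x \<in> lp_space p \<Longrightarrow> norm (f x) \<le> C * lp_norm p x"
    using f by (auto simp: lp_dual_def)
  \<comment> \<open>The ratio by which the bound for \<open>block_vec p k\<close> shrinks: the
    support doubles while each entry is divided by \<open>2 powr (1 / p)\<close>.\<close>
  define q :: real where "q = 2 powr (1 - 1 / p)"
  have "q < 2 powr 0" unfolding q_def using p by (intro powr_less_mono) (auto simp: field_simps)
  then have q: "0 < q" "q < 1" by (simp_all add: q_def)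
  have le: "norm (f (block_vec p k)) \<le> \<bar>C\<bar> * q ^ k" for k
  proof -
    have "norm (f (block_vec p k)) \<le> 2 ^ k * (C * norm (of_real (2 powr (- real k / p)) :: 'a))"
      using dual_norm_finite_indicator[OF p(1) lin C, of "(\<lambda>i. prod_encode (k, i)) ` {..<2 ^ k}"
          "of_real (2 powr (- real k / p))"]
      unfolding block_vec_def card_block by (simp only: finite_imageI finite_lessThan of_nat_power of_nat_numeral)
    also have "\<dots> = C * (2 ^ k * 2 powr (- real k / p))" unfolding norm_of_real by simp
    also have "2 ^ k * 2 powr (- real k / p) = q ^ k"
    proof -
      have "2 ^ k * 2 powr (- real k / p) = 2 powr (real k + (- real k / p))"
        by (simp only: powr_add) (simp add: powr_realpow)
      also have "\<dots> = 2 powr ((1 - 1 / p) * real k)" by (simp add: algebra_simps)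
      also have "\<dots> = q ^ k" using q(1) by (simp only: q_def powr_realpow flip: powr_powr)
      finally show ?thesis .
    qed
    also have "C * q ^ k \<le> \<bar>C\<bar> * q ^ k" using q by (intro mult_right_mono) auto
    finally show ?thesis .
  qed
  have "q powr s < 1 powr s" using q \<open>s > 0\<close> by (intro powr_less_mono2) auto
  then have "summable (\<lambda>k. (q powr s) ^ k)" by (intro summable_geometric) simp
  then have sm: "summable (\<lambda>k. \<bar>C\<bar> powr s * (q powr s) ^ k)" by (rule summable_mult)
  have "norm (f (block_vec p k)) powr s \<le> \<bar>C\<bar> powr s * (q powr s) ^ k" for k
  proof -
    have "norm (f (block_vec p k)) powr s \<le> (\<bar>C\<bar> * q ^ k) powr s"
      using le \<open>s > 0\<close> by (intro powr_mono2) auto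
    also have "\<dots> = \<bar>C\<bar> powr s * (q ^ k) powr s" by (rule powr_mult)
    also have "(q ^ k) powr s = (q powr real k) powr s" using q by (simp only: powr_realpow)
    also have "\<dots> = (q powr s) powr real k" by (simp only: powr_powr mult.commute)
    also have "\<dots> = (q powr s) ^ k" using q by (intro powr_realpow) simp
    finally show ?thesis .
  qed
  then show ?thesis
    by (intro summable_comparison_test'[OF sm, where N = 0]) simp
qed

text \<open>The block vectors are weakly \<open>s\<close>-summable, while their images have norm
  \<open>norm (m k)\<close>. Summability of the powers would force these to tend to 0, but the value
  \<open>norm c\<close> recurs infinitely often.\<close>

lemma block_mult_not_abs_summing:
  fixes m :: "nat \<Rightarrow> 'a::real_normed_field"
  assumes p: "0 < p" "p < 1" and "1 \<le> s" and c: "c \<noteq> 0" "infinite {k. m k = c}"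
  shows "\<not> abs_summing p r s (block_mult p m)"
proof
  assume "abs_summing p r s (block_mult p m)"
  moreover have "\<forall>k. block_vec p k \<in> (lp_space p :: (nat \<Rightarrow> 'a) set)"
    using p block_vec_lp(1) by blast
  moreover have "\<forall>f\<in>lp_dual p. summable (\<lambda>k. norm (f (block_vec p k) :: 'a) powr s)"
    using block_vec_weakly_summable[OF p, of s] \<open>1 \<le> s\<close> by auto
  ultimately have "summable (\<lambda>k. lp_norm p (block_mult p m (block_vec p k)) powr r)"
    unfolding abs_summing_def by blast
  then have "summable (\<lambda>k. norm (m k) powr r)"
    using p by (simp add: block_mult_block_vec block_vec_lp)
  then have "(\<lambda>k. norm (m k) powr r) \<longlonglongrightarrow> 0" by (rule summable_LIMSEQ_zero)
  moreover have "norm c powr r > 0" using c by simp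
  ultimately have "\<forall>\<^sub>F k in sequentially. norm (m k) powr r < norm c powr r"
    by (rule order_tendstoD(2))
  then have "\<forall>\<^sub>F k in sequentially. m k \<noteq> c"
    by (rule eventually_mono) auto
  then have "finite {k. m k = c}"
    by (simp add: eventually_cofinite flip: cofinite_eq_sequentially)
  with c show False by simp
qed

section \<open>An almost disjoint family indexed by the reals\<close>

text \<open>The graph of \<open>n \<mapsto> \<lfloor>n * t\<rfloor>\<close>, coded as a set of
  naturals. Graphs are infinite, and two of them meet only where the functions agree.\<close>

definition floor_set :: "real \<Rightarrow> nat set" where
  "floor_set t = range (\<lambda>n. prod_encode (n, int_encode \<lfloor>real n * t\<rfloor>))"

lemma infinite_floor_set: "infinite (floor_set t)"
  unfolding floor_set_def by (intro range_inj_infinite injI) simp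

lemma finite_floor_set_Int:
  assumes "s \<noteq> t"
  shows "finite (floor_set s \<inter> floor_set t)"
proof -
  \<comment> \<open>From \<open>n = K\<close> on, \<open>n * s\<close> and \<open>n * t\<close> are
    more than 1 apart, so their floors differ.\<close>
  obtain K where K: "1 < real K * \<bar>s - t\<bar>"
    using reals_Archimedean3[of "\<bar>s - t\<bar>"] assms by (auto simp: dist_real_def)
  have "n < K" if eq: "\<lfloor>real n * s\<rfloor> = \<lfloor>real n * t\<rfloor>" for n
  proof (rule ccontr)
    assume "\<not> n < K"
    then have "real K * \<bar>s - t\<bar> \<le> real n * \<bar>s - t\<bar>" by (intro mult_right_mono) auto
    moreover have "real n * \<bar>s - t\<bar> = \<bar>real n * s - real n * t\<bar>"
      by (simp add: abs_mult flip: right_diff_distrib)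
    moreover have "\<bar>real n * s - real n * t\<bar> < 1" using eq by linarith
    ultimately show False using K by linarith
  qed
  then have "floor_set s \<inter> floor_set t \<subseteq> (\<lambda>n. prod_encode (n, int_encode \<lfloor>real n * s\<rfloor>)) ` {..<K}"
    by (auto simp: floor_set_def inj_eq[OF inj_int_encode])
  then show ?thesis by (rule finite_subset) simp
qed

interpretation ops: module "op_scale :: 'a::real_normed_field \<Rightarrow> _"
  by unfold_locales (auto simp: op_scale_def fun_eq_iff algebra_simps)

text \<open>Outside its finite intersections with the other sets, \<open>floor_set t\<close> is
  still infinite, and there only the summand of \<open>t\<close> survives.\<close>

lemma floor_set_combination_infinitely_often:
  fixes c :: "real \<Rightarrow> 'a::real_normed_field"
  assumes "finite S" "t \<in> S"
  shows "infinite {k. (\<Sum>u\<in>S. if k \<in> floor_set u then c u else 0) = c t}"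
proof -
  have "finite (\<Union>u\<in>S - {t}. floor_set t \<inter> floor_set u)"
    using assms(1) by (intro finite_UN_I finite_floor_set_Int) auto
  then have inf: "infinite (floor_set t - (\<Union>u\<in>S - {t}. floor_set t \<inter> floor_set u))"
    by (intro Diff_infinite_finite infinite_floor_set)
  have "(\<Sum>u\<in>S. if k \<in> floor_set u then c u else 0) = c t"
    if "k \<in> floor_set t - (\<Union>u\<in>S - {t}. floor_set t \<inter> floor_set u)" for k
  proof -
    have "(\<Sum>u\<in>S. if k \<in> floor_set u then c u else 0) = (\<Sum>u\<in>S. if u = t then c u else 0)"
      using that by (intro sum.cong) auto
    then show ?thesis using assms by simp
  qed
  then have "floor_set t - (\<Union>u\<in>S - {t}. floor_set t \<inter> floor_set u)
      \<subseteq> {k. (\<Sum>u\<in>S. if k \<in> floor_set u then c u else 0) = c t}"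
    by blast
  then show ?thesis using inf by (rule infinite_super)
qed

section \<open>The operators spanning the subspace\<close>

definition floor_op :: "real \<Rightarrow> real \<Rightarrow> (nat \<Rightarrow> 'a::real_normed_field) \<Rightarrow> nat \<Rightarrow> 'a" where
  "floor_op p t = block_mult p (\<lambda>k. if k \<in> floor_set t then 1 else 0)"

lemma sum_floor_op:
  "finite S \<Longrightarrow> (\<Sum>t\<in>S. op_scale (c t) (floor_op p t)) =
     block_mult p (\<lambda>k. \<Sum>t\<in>S. if k \<in> floor_set t then c t else 0)"
proof (induction S rule: finite_induct)
  case empty
  show ?case by (simp add: block_mult_def fun_eq_iff)
next
  case (insert t S)
  show ?case
    unfolding sum.insert[OF insert.hyps] insert.IH
    by (simp add: fun_eq_iff op_scale_def floor_op_def block_mult_def distrib_right)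
qed

text \<open>At an index \<open>k\<close> where the combined multiplier equals \<open>c t\<close>,
  the vanishing operator sends the unit vector \<open>block_vec p k\<close> to a vector of norm
  \<open>norm (c t)\<close>.\<close>

lemma floor_op_combination_eq_0:
  fixes c :: "real \<Rightarrow> 'a::real_normed_field"
  assumes p: "p > 0" and "finite S" "(\<Sum>t\<in>S. op_scale (c t) (floor_op p t)) = 0" "t \<in> S"
  shows "c t = 0"
proof -
  obtain k where k: "(\<Sum>u\<in>S. if k \<in> floor_set u then c u else 0) = c t"
    using infinite_imp_nonempty[OF floor_set_combination_infinitely_often[OF assms(2,4), of c]] by blast
  have "block_mult p (\<lambda>k. \<Sum>t\<in>S. if k \<in> floor_set t then c t else 0) (block_vec p k) = 0"
    using assms by (simp add: sum_floor_op[symmetric])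
  then have "(\<lambda>j. c t * block_vec p k j) = (0 :: nat \<Rightarrow> 'a)"
    using p k by (simp add: block_mult_block_vec)
  then have "norm (c t) = lp_norm p (\<lambda>j. 0 * block_vec p k j :: 'a)"
    using block_vec_lp(2)[OF p, of "c t" k] by (simp add: zero_fun_def)
  then show ?thesis unfolding block_vec_lp(2)[OF p] by simp
qed

lemma inj_floor_op:
  assumes p: "p > 0"
  shows "inj (floor_op p :: real \<Rightarrow> (nat \<Rightarrow> 'a::real_normed_field) \<Rightarrow> _)"
proof (rule injI, rule ccontr)
  fix s t :: real
  assume eq: "floor_op p s = (floor_op p t :: (nat \<Rightarrow> 'a) \<Rightarrow> _)" and "s \<noteq> t"
  \<comment> \<open>If two operators with distinct indices coincided, their difference would be a
    nontrivial vanishing combination.\<close>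
  define c :: "real \<Rightarrow> 'a" where "c u = (if u = s then 1 else - 1)" for u
  have "(\<Sum>u\<in>{s, t}. op_scale (c u) (floor_op p u)) = 0"
    using \<open>s \<noteq> t\<close> eq by (simp add: c_def ops.scale_minus_left)
  from floor_op_combination_eq_0[OF p _ this, of s] show False by (simp add: c_def)
qed

text \<open>Replaces linear combinations over sets of operators by combinations over their real
  indices, where the multipliers can be computed.\<close>

lemma finite_subset_range_floor_opE:
  fixes V :: "((nat \<Rightarrow> 'a::real_normed_field) \<Rightarrow> nat \<Rightarrow> 'a) set"
  assumes "p > 0" "finite V" "V \<subseteq> range (floor_op p)"
  obtains S where "finite S" "V = floor_op p ` S" 
    "\<And>r. (\<Sum>v\<in>V. op_scale (r v) v) = (\<Sum>t\<in>S. op_scale (r (floor_op p t)) (floor_op p t))"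
proof -
  obtain S where S: "finite S" "V = floor_op p ` S"
    using finite_subset_image[OF assms(2,3)] by blast
  have "inj_on (floor_op p :: real \<Rightarrow> (nat \<Rightarrow> 'a) \<Rightarrow> _) S"
    using inj_floor_op[OF assms(1)] by (rule inj_on_subset) simp
  with S show ?thesis by (intro that[of S]) (simp_all add: sum.reindex)
qed

lemma independent_floor_op:
  assumes p: "p > 0"
  shows "module.independent op_scale (range (floor_op p :: real \<Rightarrow> (nat \<Rightarrow> 'a::real_normed_field) \<Rightarrow> _))"
proof
  assume "module.dependent op_scale (range (floor_op p :: real \<Rightarrow> (nat \<Rightarrow> 'a) \<Rightarrow> _))"
  then obtain V r v where V: "finite V" "V \<subseteq> range (floor_op p :: real \<Rightarrow> (nat \<Rightarrow> 'a) \<Rightarrow> _)"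
    and sum: "(\<Sum>v\<in>V. op_scale (r v) v) = 0" and v: "v \<in> V" "r v \<noteq> 0"
    unfolding ops.dependent_explicit by blast
  from p V obtain S where S: "finite S" "V = floor_op p ` S"
    "\<And>r. (\<Sum>v\<in>V. op_scale (r v) v) = (\<Sum>t\<in>S. op_scale (r (floor_op p t)) (floor_op p t))"
    by (rule finite_subset_range_floor_opE) blast
  from v S obtain t where "t \<in> S" "v = floor_op p t" by blast
  with floor_op_combination_eq_0[OF p S(1), of "\<lambda>t. r (floor_op p t)"] S(3) sum v(2)
  show False by simp
qed

text \<open>An element of the span is multiplication by a finite combination of indicators, hence by
  a bounded sequence. If the element is nonzero, some coefficient \<open>c t\<close> is nonzero, and
  the sequence takes this value infinitely often.\<close>

lemma span_floor_op:
  fixes T :: "(nat \<Rightarrow> 'a::real_normed_field) \<Rightarrow> nat \<Rightarrow> 'a"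
  assumes p: "0 < p" "p < 1" and T: "T \<in> module.span op_scale (range (floor_op p))" "T \<noteq> 0"
  shows "T \<in> bounded_ops p" "1 \<le> s \<Longrightarrow> \<not> abs_summing p r s T"
proof -
  obtain V a where V: "finite V" "V \<subseteq> range (floor_op p)" and TV: "T = (\<Sum>v\<in>V. op_scale (a v) v)"
    using T(1) unfolding ops.span_explicit by blast
  from p(1) V obtain S where S: "finite S"
    "\<And>r. (\<Sum>v\<in>V. op_scale (r v) v) = (\<Sum>t\<in>S. op_scale (r (floor_op p t)) (floor_op p t))"
    by (rule finite_subset_range_floor_opE) blast
  define c where "c t = a (floor_op p t)" for t
  define m where "m k = (\<Sum>t\<in>S. if k \<in> floor_set t then c t else 0)" for k
  have TS: "T = (\<Sum>t\<in>S. op_scale (c t) (floor_op p t))" by (simp add: TV S c_def)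
  have Tm: "T = block_mult p m"
    unfolding TS m_def by (rule sum_floor_op[OF S(1)])
  have "norm (m k) \<le> (\<Sum>t\<in>S. norm (c t))" for k
    unfolding m_def by (intro order.trans[OF norm_sum] sum_mono) auto
  then show "T \<in> bounded_ops p"
    unfolding Tm using p by (intro block_mult_in_bounded_ops) auto
  have "\<exists>t\<in>S. c t \<noteq> 0"
  proof (rule ccontr)
    assume "\<not> (\<exists>t\<in>S. c t \<noteq> 0)"
    then have "T = 0" unfolding TS by (simp add: ops.scale_zero_left)
    with T(2) show False by simp
  qed
  then obtain t where t: "t \<in> S" "c t \<noteq> 0" by blast
  show "\<not> abs_summing p r s T" if "1 \<le> s"
    unfolding Tm using floor_set_combination_infinitely_often[OF S(1) t(1), of c] p t(2) that
    by (intro block_mult_not_abs_summing[of p s "c t"]) (simp_all add: m_def)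
qed

theorem theorem3p1:
  fixes p :: real
  shows "(0 < p \<and> p < 1 \<longrightarrow>
           (\<exists>B :: ((nat \<Rightarrow> 'a::real_normed_field) \<Rightarrow> (nat \<Rightarrow> 'a)) set.
              B \<approx> (UNIV :: real set) \<and>
              module.independent op_scale B \<and>
              module.span op_scale B \<subseteq>
                {T \<in> bounded_ops p. \<not> (\<exists>r s. 1 \<le> s \<and> s \<le> r \<and> abs_summing p r s T)} \<union> {0}))
       \<and> (1 \<le> p \<longrightarrow>
           (\<forall>T \<in> (bounded_ops p :: ((nat \<Rightarrow> 'a) \<Rightarrow> (nat \<Rightarrow> 'a)) set).
              \<exists>r s. 1 \<le> s \<and> s \<le> r \<and> abs_summing p r s T))"
proof (intro conjI impI)
  assume p: "0 < p \<and> p < 1"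
  let ?B = "range (floor_op p :: real \<Rightarrow> (nat \<Rightarrow> 'a) \<Rightarrow> _)"
  have "?B \<approx> (UNIV :: real set)"
    using p by (intro inj_on_image_eqpoll_self inj_floor_op) simp
  moreover have "module.independent op_scale ?B"
    using p by (intro independent_floor_op) simp
  moreover have "module.span op_scale ?B \<subseteq>
      {T \<in> bounded_ops p. \<not> (\<exists>r s. 1 \<le> s \<and> s \<le> r \<and> abs_summing p r s T)} \<union> {0}"
    using p span_floor_op[of p] by blast
  ultimately show "\<exists>B :: ((nat \<Rightarrow> 'a) \<Rightarrow> (nat \<Rightarrow> 'a)) set. B \<approx> (UNIV :: real set) \<and>
      module.independent op_scale B \<and>
      module.span op_scale B \<subseteq>
        {T \<in> bounded_ops p. \<not> (\<exists>r s. 1 \<le> s \<and> s \<le> r \<and> abs_summing p r s T)} \<union> {0}"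
    by blast
next
  assume p: "1 \<le> p"
  show "\<forall>T \<in> (bounded_ops p :: ((nat \<Rightarrow> 'a) \<Rightarrow> (nat \<Rightarrow> 'a)) set).
      \<exists>r s. 1 \<le> s \<and> s \<le> r \<and> abs_summing p r s T"
  proof
    fix T :: "(nat \<Rightarrow> 'a) \<Rightarrow> (nat \<Rightarrow> 'a)"
    assume "T \<in> bounded_ops p"
    with p have "abs_summing p (max 2 p) 1 T" by (rule bounded_ops_abs_summing)
    then show "\<exists>r s. 1 \<le> s \<and> s \<le> r \<and> abs_summing p r s T"
      by (intro exI[of _ "max 2 p"] exI[of _ 1]) simp
  qed
qed

end
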